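(* Let $T>0$, $l>0$, $\alpha,\beta>0$, let $V\in C^1(\mathbb{R}_{>0};\mathbb{R}_{\ge 0})\cap L^\infty(\mathbb{R}_{\ge 0})$ with $V'\ge 0$, let $N,M\in\mathbb{N}_{\ge1}$, $I=\{1,\dots,N+M\}$, $I_a\subset I$ with $|I_a|=M$, $I_h=I\setminus I_a$. Let the leader trajectory $x_\ell$, the initial data $x_\circ,v_\circ$ and $0<d_{\mathrm{safe}}\le d_\circ$ satisfy the standing assumptions in the context, and let $a_{\max}>0$. For $a_{\min}<0$ let $U$ (depending on $a_{\min}$) be the set of admissible controls defined in the context. Then for all sufficiently small $a_{\min}<0$ the set $U$ is non-empty; that is, there exists $\bar a<0$ such that $U\neq\emptyset$ for every $a_{\min}\le\bar a$. Additionally, for every such $a_{\min}$ and every $u\in U$ there exists a unique solution $(x,v)$ on $[0,T]$ of the system dynamics (given in the context) with control $u$.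
   Context: Standing assumptions. (1) Leader: $x_\ell\in W^{2,\infty}((0,T))$ with $v_\ell:=\dot x_\ell\ge 0$ on $[0,T]$. (2) Initial data: $x_\circ\in\mathbb{R}^{|I|}$, $v_\circ\in\mathbb{R}_{\ge0}^{|I|}$, and there is $d_\circ>0$ with $x_\ell(0)-x_{\circ,1}-l>d_\circ$ and $x_{\circ,i}-x_{\circ,i+1}-l>d_\circ$ for $i=1,\dots,N+M-1$. Here $l$ is the vehicle length, $I_a$ indexes autonomous vehicles, $I_h$ human-driven vehicles; $0<d_{\mathrm{safe}}\le d_\circ$. Acceleration function (Bando-Follow-the-Leader): on $\{(x,x_\ell,v,v_\ell)\in\mathbb{R}^4: x_\ell-x-l>0\}$, $$\mathrm{Acc}(x,x_\ell,v,v_\ell)=\alpha\big(V(x_\ell-x-l)-v\big)+\beta\frac{v_\ell-v}{(x_\ell-x-l)^2}.$$ System dynamics with control $u$: with $x_0:=x_\ell$, $v_0:=v_\ell$, for $t\in[0,T]$, $$\dot x_i=v_i\ (i\in I),\quad \dot v_i=\mathrm{Acc}(x_i,x_{i-1},v_i,v_{i-1})\ (i\in I_h),\quad \dot v_i=u_i\ (i\in I_a),\quad x(0)=x_\circ,\ v(0)=v_\circ.$$ A solution is a pair $(x,v)\in W^{2,\infty}((0,T);\mathbb{R}^{|I|})\times W^{1,\infty}((0,T);\mathbb{R}^{|I|})$ satisfying the initial conditions, the equations for a.e. $t$, and $x_{i-1}(t)-x_i(t)-l>0$ for all $t\in[0,T]$, $i\in I_h$ (so that $\mathrm{Acc}$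 is defined). Control sets: $U_{a_{\min}}^{a_{\max}}$ is the set of $u\in L^\infty((0,T);\mathbb{R}^{|I|})$ with $u_i\equiv0$ for $i\in I_h$, and, for $i\in I_a$, $a_{\min}\le u_i(t)\le a_{\max}$ for a.e. $t\in[0,T]$ and $v_{\circ,i}+\int_0^t u_i(s)\,ds\ge0$ for all $t\in[0,T]$. The admissible set $U$ is the set of $u\in U_{a_{\min}}^{a_{\max}}$ such that every solution $(x,v)$ of the system with control $u$ satisfies $x_{i-1}(t)-x_i(t)-l\ge d_{\mathrm{safe}}$ for all $t\in[0,T]$, $i\in I_a$. *)

theory Defs
  imports "HOL-Analysis.Analysis"
begin

definition Linfty :: "real set \<Rightarrow> (real \<Rightarrow> real) \<Rightarrow> bool" where
  "Linfty S f \<longleftrightarrow> f \<in> borel_measurable (lebesgue_on S) \<and> (\<exists>C. AE t in lebesgue_on S. \<bar>f t\<bar> \<le> C)"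

definition L1_loc :: "real \<Rightarrow> (real \<Rightarrow> real) \<Rightarrow> bool" where
  "L1_loc T f \<longleftrightarrow> (\<forall>K. compact K \<and> K \<subseteq> {0<..<T} \<longrightarrow> integrable (lebesgue_on K) f)"

(* The space of C^1 functions with compact support in (0,T), extended by zero to the real line. *)
definition test_function :: "real \<Rightarrow> (real \<Rightarrow> real) \<Rightarrow> bool" where
  "test_function T \<phi> \<longleftrightarrow>
     \<phi> C1_differentiable_on UNIV \<and> (\<exists>K. compact K \<and> K \<subseteq> {0<..<T} \<and> (\<forall>t. t \<notin> K \<longrightarrow> \<phi> t = 0))"

(* g is a weak derivative of f on (0,T).  Weak derivatives are unique only almost everywhere,
   hence a relation. *)
definition has_weak_derivative :: "real \<Rightarrow> (real \<Rightarrow> real) \<Rightarrow> (real \<Rightarrow> real) \<Rightarrow> bool" where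
  "has_weak_derivative T f g \<longleftrightarrow> L1_loc T f \<and> L1_loc T g \<and>
     (\<forall>\<phi>. test_function T \<phi> \<longrightarrow>
        (LINT t|lebesgue_on {0<..<T}. f t * deriv \<phi> t) = - (LINT t|lebesgue_on {0<..<T}. g t * \<phi> t))"

(* Membership in the Sobolev space W^{k,infinity}((0,T)).  The predicate is invariant under changes
   on null sets; wherever the values of a Sobolev function at single points of [0,T] matter,
   continuity on [0,T] is required separately, which selects the continuous representative. *)
primrec sobolev_inf :: "nat \<Rightarrow> real \<Rightarrow> (real \<Rightarrow> real) \<Rightarrow> bool" where
  "sobolev_inf 0 T f \<longleftrightarrow> Linfty {0<..<T} f"
| "sobolev_inf (Suc k) T f \<longleftrightarrow>
     Linfty {0<..<T} f \<and> (\<exists>g. has_weak_derivative T f g \<and> sobolev_inf k T g)"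

(* Meaningful only for y - x - l > 0, which is part of the notion of solution below. *)
definition Acc :: "real \<Rightarrow> real \<Rightarrow> (real \<Rightarrow> real) \<Rightarrow> real \<Rightarrow> real \<Rightarrow> real \<Rightarrow> real \<Rightarrow> real \<Rightarrow> real" where
  "Acc \<alpha> \<beta> V l x y v w = \<alpha> * (V (y - x - l) - v) + \<beta> * ((w - v) / (y - x - l)\<^sup>2)"

(* Trajectories are functions of the vehicle index and of time.  Only indices in I and times
   in [0,T] are constrained.  The update at index 0 encodes x_0 := x_l, v_0 := v_l. *)
definition is_solution ::
  "real \<Rightarrow> real \<Rightarrow> real \<Rightarrow> real \<Rightarrow> (real \<Rightarrow> real) \<Rightarrow> nat set \<Rightarrow> nat set \<Rightarrow>
   (real \<Rightarrow> real) \<Rightarrow> (real \<Rightarrow> real) \<Rightarrow> (nat \<Rightarrow> real) \<Rightarrow> (nat \<Rightarrow> real) \<Rightarrow>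
   (nat \<Rightarrow> real \<Rightarrow> real) \<Rightarrow> (nat \<Rightarrow> real \<Rightarrow> real) \<Rightarrow> (nat \<Rightarrow> real \<Rightarrow> real) \<Rightarrow> bool" where
  "is_solution T l \<alpha> \<beta> V I Ia xl vl xo vo u x v \<longleftrightarrow>
     (\<forall>i\<in>I. sobolev_inf 2 T (x i) \<and> continuous_on {0..T} (x i) \<and>
            sobolev_inf 1 T (v i) \<and> continuous_on {0..T} (v i)) \<and>
     (\<forall>i\<in>I. x i 0 = xo i \<and> v i 0 = vo i) \<and>
     (\<forall>i\<in>I. \<exists>x'. has_weak_derivative T (x i) x' \<and> (AE t in lebesgue_on {0..T}. x' t = v i t)) \<and>
     (\<forall>i\<in>I - Ia. \<exists>v'. has_weak_derivative T (v i) v' \<and>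
        (AE t in lebesgue_on {0..T}.
           v' t = Acc \<alpha> \<beta> V l (x i t) ((x(0 := xl)) (i - 1) t) (v i t) ((v(0 := vl)) (i - 1) t))) \<and>
     (\<forall>i\<in>Ia. \<exists>v'. has_weak_derivative T (v i) v' \<and> (AE t in lebesgue_on {0..T}. v' t = u i t)) \<and>
     (\<forall>i\<in>I - Ia. \<forall>t\<in>{0..T}. (x(0 := xl)) (i - 1) t - x i t - l > 0)"

definition control_set ::
  "real \<Rightarrow> nat set \<Rightarrow> nat set \<Rightarrow> (nat \<Rightarrow> real) \<Rightarrow> real \<Rightarrow> real \<Rightarrow> (nat \<Rightarrow> real \<Rightarrow> real) set" where
  "control_set T I Ia vo a_min a_max =
     {u. (\<forall>i\<in>I. Linfty {0<..<T} (u i)) \<and>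
         (\<forall>i\<in>I - Ia. AE t in lebesgue_on {0..T}. u i t = 0) \<and>
         (\<forall>i\<in>Ia. (AE t in lebesgue_on {0..T}. a_min \<le> u i t \<and> u i t \<le> a_max) \<and>
                 (\<forall>t\<in>{0..T}. vo i + (LINT s|lebesgue_on {0..t}. u i s) \<ge> 0))}"

definition admissible_controls ::
  "real \<Rightarrow> real \<Rightarrow> real \<Rightarrow> real \<Rightarrow> (real \<Rightarrow> real) \<Rightarrow> nat set \<Rightarrow> nat set \<Rightarrow>
   (real \<Rightarrow> real) \<Rightarrow> (real \<Rightarrow> real) \<Rightarrow> (nat \<Rightarrow> real) \<Rightarrow> (nat \<Rightarrow> real) \<Rightarrow>
   real \<Rightarrow> real \<Rightarrow> real \<Rightarrow> (nat \<Rightarrow> real \<Rightarrow> real) set" where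
  "admissible_controls T l \<alpha> \<beta> V I Ia xl vl xo vo d_safe a_min a_max =
     {u \<in> control_set T I Ia vo a_min a_max.
        \<forall>x v. is_solution T l \<alpha> \<beta> V I Ia xl vl xo vo u x v \<longrightarrow>
          (\<forall>i\<in>Ia. \<forall>t\<in>{0..T}. (x(0 := xl)) (i - 1) t - x i t - l \<ge> d_safe)}"

(* Solutions are identified when they agree for all vehicles in I and all times in [0,T]. *)
definition ex_unique_solution ::
  "real \<Rightarrow> real \<Rightarrow> real \<Rightarrow> real \<Rightarrow> (real \<Rightarrow> real) \<Rightarrow> nat set \<Rightarrow> nat set \<Rightarrow>
   (real \<Rightarrow> real) \<Rightarrow> (real \<Rightarrow> real) \<Rightarrow> (nat \<Rightarrow> real) \<Rightarrow> (nat \<Rightarrow> real) \<Rightarrow>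
   (nat \<Rightarrow> real \<Rightarrow> real) \<Rightarrow> bool" where
  "ex_unique_solution T l \<alpha> \<beta> V I Ia xl vl xo vo u \<longleftrightarrow>
     (\<exists>x v. is_solution T l \<alpha> \<beta> V I Ia xl vl xo vo u x v \<and>
        (\<forall>y w. is_solution T l \<alpha> \<beta> V I Ia xl vl xo vo u y w \<longrightarrow>
           (\<forall>i\<in>I. \<forall>t\<in>{0..T}. y i t = x i t \<and> w i t = v i t)))"

end

theory Submission
  imports Defs
begin

text \<open>
  The dynamics are a cascade: each vehicle sees only the vehicle in front of it, so everything
  reduces to one vehicle driving behind a given trajectory \<open>(y, w)\<close> whose velocity \<open>w\<close> is
  continuous and nonnegative, and the platoon follows by induction along the lane. For the
  induction each vehicle has to hand a nonnegative velocity on to its successor.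

  An autonomous vehicle with control \<open>u\<close> has the explicit velocity \<open>v\<^sub>0 + \<integral> u\<close>, which membership
  in the control set makes nonnegative. For a human driver with gap \<open>h = y - x - l\<close> the velocity
  satisfies \<open>v' + (\<alpha> + \<beta>/h\<^sup>2) v = \<alpha> V(h) + \<beta> w/h\<^sup>2 \<ge> 0\<close>, so an integrating factor gives
  \<open>v \<ge> 0\<close> (\<open>gap_system_velocity_nonneg\<close>). The singular term of the acceleration is an exact
  derivative: \<open>h' = w - v\<close> turns the equation for \<open>v\<close> into \<open>(v + \<beta>/h)' = \<alpha> (V(h) - v)\<close>. As \<open>V\<close>
  is bounded and \<open>v \<ge> 0\<close>, the quantity \<open>v + \<beta>/h\<close> grows at most linearly, and this bounds the gap
  away from zero on \<open>[0,T]\<close> (\<open>gap_system_potential_bound\<close>). In the variables \<open>(h, v + \<beta>/h)\<close> the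
  system is globally Lipschitz once \<open>h\<close> is clamped to a compact interval of positive gaps, and by
  the a priori bounds the clamping never becomes active. Global existence
  (\<open>gap_system_exists\<close>) and uniqueness (\<open>gap_system_unique\<close>) are then the
  Picard--Lindeloef theorem for the clamped system.

  Solutions are defined through weak derivatives. For continuous \<open>f\<close> and essentially bounded
  \<open>g\<close>, having \<open>g\<close> as weak derivative amounts to \<open>f(t) = f(0) + \<integral>\<^sub>0\<^sup>t g\<close>
  (\<open>weak_derivative_iff_primitive\<close>), which translates the notion of solution into the classical
  one (\<open>is_solution_iff_classical\<close>).

  An admissible control exists because stopping distances are small under hard braking: let every
  autonomous vehicle decelerate at the constant rate \<open>b = - a_min\<close> until it stands still. It then
  advances at most \<open>v\<^sub>0\<^sup>2/b\<close>, while the vehicle in front never moves backwards, so the gap is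
  at least \<open>d_safe\<close> as soon as \<open>v\<^sub>0\<^sup>2/b\<close> is at most the slack between the initial gap and \<open>d_safe\<close>.
  This slack is positive for every vehicle, and there are finitely many vehicles.
\<close>

section \<open>Ordinary differential equations with a Lipschitz right-hand side\<close>

text \<open>Picard iteration on the whole interval at once: in the unknown \<open>y t = exp (- 2 L t) z t\<close> the
  integral operator is a contraction with factor \<open>1/2\<close>, because the weight turns \<open>\<integral>\<^sub>0\<^sup>t L\<close> into
  \<open>exp (- 2 L t) \<integral>\<^sub>0\<^sup>t L exp (2 L s) ds \<le> 1/2\<close>. Continuity of the right-hand side is asked for
  along continuous curves, the only place where it is evaluated.\<close>

lemma lipschitz_ode_solution:
  fixes F :: "real \<Rightarrow> 'a::banach \<Rightarrow> 'a"
  assumes T: "0 \<le> T" and L: "0 < L"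
    and cont: "\<And>z. continuous_on {0..T} z \<Longrightarrow> continuous_on {0..T} (\<lambda>t. F t (z t))"
    and lip: "\<And>t z z'. t \<in> {0..T} \<Longrightarrow> norm (F t z - F t z') \<le> L * norm (z - z')"
  obtains z where "z 0 = z0"
    and "\<And>t. t \<in> {0..T} \<Longrightarrow> (z has_vector_derivative F t (z t)) (at t within {0..T})"
proof -
  define G where "G y t = exp (- (2 * L) * t) *\<^sub>R
      (z0 + integral {0..t} (\<lambda>s. F s (exp (2 * L * s) *\<^sub>R y s)))" for y t
  have contF: "continuous_on {0..T} (\<lambda>s. F s (exp (2 * L * s) *\<^sub>R apply_bcontfun y s))" for y
    by (intro cont continuous_intros) auto
  have contG: "continuous_on {0..T} (G (apply_bcontfun y))" for y
    unfolding G_def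
    by (intro continuous_intros indefinite_integral_continuous_1 integrable_continuous_real contF)
  \<comment> \<open>Bounded continuous functions live on all of \<open>\<real>\<close>; the iterates are extended by clamping time.\<close>
  have "\<exists>g. \<forall>t. apply_bcontfun g t = G (apply_bcontfun y) (clamp 0 T t)" for y
  proof -
    obtain g where "\<And>t. apply_bcontfun g t = G (apply_bcontfun y) (clamp 0 T t)"
      using continuous_on_cbox_bcontfunE[of 0 T "G (apply_bcontfun y)"] contG[of y]
      by (auto simp: cbox_interval)
    then show ?thesis by blast
  qed
  then obtain \<Phi> where \<Phi>: "\<And>y t. apply_bcontfun (\<Phi> y) t = G (apply_bcontfun y) (clamp 0 T t)"
    by metis
  have contr: "dist (\<Phi> y) (\<Phi> y') \<le> 1/2 * dist y y'" for y y'
  proof (rule dist_bound)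
    fix r :: real
    define t where "t = clamp 0 T r"
    have t: "t \<in> {0..T}"
      using clamp_in_interval[of 0 T r] T by (auto simp: t_def cbox_interval)
    define d where "d = dist y y'"
    let ?f = "\<lambda>y s. F s (exp (2 * L * s) *\<^sub>R apply_bcontfun y s)"
    have int: "?f y integrable_on {0..t}" for y
      using t by (intro integrable_continuous_real continuous_on_subset[OF contF]) auto
    have expint: "((\<lambda>s. L * exp (2 * L * s) * d) has_integral
        (exp (2 * L * t) / 2 * d - exp (2 * L * 0) / 2 * d)) {0..t}"
    proof (rule fundamental_theorem_of_calculus)
      show "0 \<le> t" using t by simp
    next
      fix s assume "s \<in> {0..t}"
      show "((\<lambda>s. exp (2 * L * s) / 2 * d) has_vector_derivative L * exp (2 * L * s) * d)
              (at s within {0..t})"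
        unfolding has_real_derivative_iff_has_vector_derivative[symmetric]
        by (auto intro!: derivative_eq_intros)
    qed
    have "norm (integral {0..t} (\<lambda>s. ?f y s - ?f y' s))
        \<le> integral {0..t} (\<lambda>s. L * exp (2 * L * s) * d)"
    proof (rule integral_norm_bound_integral)
      show "(\<lambda>s. ?f y s - ?f y' s) integrable_on {0..t}"
        by (intro integrable_diff int)
      show "(\<lambda>s. L * exp (2 * L * s) * d) integrable_on {0..t}"
        using expint by blast
      fix s assume s: "s \<in> {0..t}"
      have "norm (?f y s - ?f y' s)
          \<le> L * norm (exp (2 * L * s) *\<^sub>R apply_bcontfun y s - exp (2 * L * s) *\<^sub>R apply_bcontfun y' s)"
        using s t by (intro lip) auto
      also have "\<dots> = L * (exp (2 * L * s) * norm (apply_bcontfun y s - apply_bcontfun y' s))"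
        by (simp flip: scaleR_diff_right)
      also have "\<dots> \<le> L * (exp (2 * L * s) * d)"
        using dist_bounded[of y s y'] L by (simp add: d_def dist_norm)
      finally show "norm (?f y s - ?f y' s) \<le> L * exp (2 * L * s) * d"
        by (simp add: mult.assoc)
    qed
    also have "\<dots> = exp (2 * L * t) / 2 * d - d / 2"
      using integral_unique[OF expint] by simp
    also have "\<dots> \<le> exp (2 * L * t) * (d / 2)"
      by (simp add: d_def)
    finally have *: "norm (integral {0..t} (?f y) - integral {0..t} (?f y')) \<le> exp (2 * L * t) * (d / 2)"
      by (simp add: integral_diff int)
    have "dist (apply_bcontfun (\<Phi> y) r) (apply_bcontfun (\<Phi> y') r)
        = exp (- (2 * L) * t) * norm (integral {0..t} (?f y) - integral {0..t} (?f y'))"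
      by (simp add: \<Phi> G_def dist_norm flip: t_def scaleR_diff_right)
    also have "\<dots> \<le> exp (- (2 * L) * t) * (exp (2 * L * t) * (d / 2))"
      using * by (intro mult_left_mono) auto
    also have "\<dots> = d / 2"
      by (simp add: exp_minus field_simps)
    finally show "dist (apply_bcontfun (\<Phi> y) r) (apply_bcontfun (\<Phi> y') r) \<le> 1/2 * dist y y'"
      by (simp add: d_def)
  qed
  then obtain y where y: "\<Phi> y = y"
    using banach_fix_type[of "1/2" \<Phi>] by auto
  define z where "z t = z0 + integral {0..t} (\<lambda>s. F s (exp (2 * L * s) *\<^sub>R apply_bcontfun y s))" for t
  have z: "z t = exp (2 * L * t) *\<^sub>R apply_bcontfun y t" if "t \<in> {0..T}" for t
  proof -
    have "apply_bcontfun y t = G (apply_bcontfun y) t"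
      using \<Phi>[of y t] that by (simp add: y clamp_cancel_cbox cbox_interval)
    also have "\<dots> = exp (- (2 * L) * t) *\<^sub>R z t"
      by (simp add: G_def z_def)
    finally show ?thesis
      by (simp flip: exp_add)
  qed
  show thesis
  proof (rule that)
    show "z 0 = z0" by (simp add: z_def)
  next
    fix t assume t: "t \<in> {0..T}"
    have "(z has_vector_derivative 0 + F t (exp (2 * L * t) *\<^sub>R apply_bcontfun y t)) (at t within {0..T})"
      unfolding z_def by (intro derivative_intros integral_has_vector_derivative contF t)
    then show "(z has_vector_derivative F t (z t)) (at t within {0..T})"
      by (simp add: z[OF t])
  qed
qed

lemma deriv_nonneg_imp_le:
  fixes f :: "real \<Rightarrow> real"
  assumes "\<And>t. t \<in> {0..T} \<Longrightarrow> (f has_real_derivative f' t) (at t within {0..T})"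
    and "\<And>t. t \<in> {0..T} \<Longrightarrow> 0 \<le> f' t" and "0 \<le> s" "s \<le> t" "t \<le> T"
  shows "f s \<le> f t"
proof -
  have "(f has_derivative (\<lambda>d. f' r * d)) (at r within {s..t})" if "s \<le> r" "r \<le> t" for r
    using assms that DERIV_subset[of f "f' r" r "{0..T}" "{s..t}"]
    by (simp add: has_field_derivative_def)
  from mvt_very_simple[OF \<open>s \<le> t\<close> this]
  obtain r where r: "r \<in> {s..t}" "f t - f s = f' r * (t - s)"
    by blast
  have "0 \<le> f' r * (t - s)"
    using r(1) assms by simp
  with r(2) show ?thesis by simp
qed

text \<open>Gronwall's argument: \<open>exp (- 2 L t) \<bar>y t - z t\<bar>\<^sup>2\<close> is nonincreasing and vanishes at \<open>0\<close>. Its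
  negative is called \<open>E\<close> in the proof.\<close>

lemma lipschitz_ode_unique:
  fixes y z :: "real \<Rightarrow> 'a::real_inner"
  assumes y: "\<And>t. t \<in> {0..T} \<Longrightarrow> (y has_vector_derivative F t (y t)) (at t within {0..T})"
    and z: "\<And>t. t \<in> {0..T} \<Longrightarrow> (z has_vector_derivative F t (z t)) (at t within {0..T})"
    and lip: "\<And>t y z. t \<in> {0..T} \<Longrightarrow> norm (F t y - F t z) \<le> L * norm (y - z)"
    and "y 0 = z 0" and t: "t \<in> {0..T}"
  shows "y t = z t"
proof -
  define E where "E t = - (exp (- (2 * L) * t) * ((y t - z t) \<bullet> (y t - z t)))" for t
  define E' where "E' t = exp (- (2 * L) * t) *
     (2 * L * ((y t - z t) \<bullet> (y t - z t)) - 2 * ((y t - z t) \<bullet> (F t (y t) - F t (z t))))" for t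
  have "E 0 \<le> E t"
  proof (rule deriv_nonneg_imp_le[where f = E and f' = E' and T = T])
    fix s assume s: "s \<in> {0..T}"
    have "((\<lambda>s. y s - z s) has_derivative (\<lambda>r. r *\<^sub>R (F s (y s) - F s (z s)))) (at s within {0..T})"
      using has_vector_derivative_diff[OF y[OF s] z[OF s]] by (simp add: has_vector_derivative_def)
    from has_derivative_inner[OF this this]
    have q: "((\<lambda>s. (y s - z s) \<bullet> (y s - z s)) has_real_derivative
        2 * ((y s - z s) \<bullet> (F s (y s) - F s (z s)))) (at s within {0..T})"
      unfolding has_field_derivative_def
      by (rule has_derivative_eq_rhs)
         (simp add: fun_eq_iff inner_commute[of "F s (y s) - F s (z s)"])
    have "((\<lambda>s. exp (- (2 * L) * s)) has_real_derivative exp (- (2 * L) * s) * (- (2 * L))) (at s within {0..T})"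
      by (auto intro!: derivative_eq_intros)
    from DERIV_minus[OF DERIV_mult[OF this q]]
    show "(E has_real_derivative E' s) (at s within {0..T})"
      unfolding E_def E'_def by (rule DERIV_cong) (simp add: right_diff_distrib)
    have "(y s - z s) \<bullet> (F s (y s) - F s (z s)) \<le> norm (y s - z s) * norm (F s (y s) - F s (z s))"
      by (rule norm_cauchy_schwarz)
    also have "\<dots> \<le> norm (y s - z s) * (L * norm (y s - z s))"
      by (intro mult_left_mono lip s) auto
    also have "\<dots> = L * ((y s - z s) \<bullet> (y s - z s))"
      by (simp add: power2_norm_eq_inner[symmetric] power2_eq_square)
    finally show "0 \<le> E' s"
      by (simp add: E'_def)
  qed (use t in auto)
  then have "(y t - z t) \<bullet> (y t - z t) \<le> 0"
    using \<open>y 0 = z 0\<close> by (simp add: E_def mult_le_0_iff)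
  then have "(y t - z t) \<bullet> (y t - z t) = 0"
    using inner_ge_zero by (rule order_antisym)
  then show ?thesis by simp
qed

section \<open>Primitives and weak derivatives\<close>

text \<open>The absolutely continuous notion of antiderivative: changing \<open>g\<close> on a null set has no effect.\<close>

definition primitive_on :: "real \<Rightarrow> (real \<Rightarrow> real) \<Rightarrow> (real \<Rightarrow> real) \<Rightarrow> bool" where
  "primitive_on T f g \<longleftrightarrow> (\<forall>t\<in>{0..T}. (g has_integral (f t - f 0)) {0..t})"

lemma primitive_on_eq:
  assumes "primitive_on T f g" "t \<in> {0..T}"
  shows "f t = f 0 + integral {0..t} g"
  using assms integral_unique[of g "f t - f 0" "{0..t}"] by (simp add: primitive_on_def)

lemma primitive_on_increment:
  assumes "primitive_on T f g" and st: "0 \<le> s" "s \<le> t" "t \<le> T"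
  shows "(g has_integral (f t - f s)) {s..t}"
proof -
  have 0: "(g has_integral (f t - f 0)) {0..t}" and 1: "(g has_integral (f s - f 0)) {0..s}"
    using assms by (auto simp: primitive_on_def)
  then have "g integrable_on {s..t}"
    using integrable_on_subinterval[of g "{0..t}" s t] st by auto
  moreover have "f s - f 0 + integral {s..t} g = f t - f 0"
    using Henstock_Kurzweil_Integration.integral_combine[of 0 s t g] 0 1 st by (auto simp: has_integral_iff)
  ultimately show ?thesis
    by (simp add: has_integral_iff)
qed

lemma primitive_on_continuous:
  assumes "primitive_on T f g"
  shows "continuous_on {0..T} f"
proof (cases "0 \<le> T")
  case True
  have eq: "f 0 + integral {0..t} g = f t" if "t \<in> {0..T}" for t
    using primitive_on_eq[OF assms that, symmetric] .
  have "g integrable_on {0..T}"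
    using assms True by (auto simp: primitive_on_def)
  then have "continuous_on {0..T} (\<lambda>t. f 0 + integral {0..t} g)"
    by (intro continuous_intros indefinite_integral_continuous_1)
  then show ?thesis
    by (rule continuous_on_eq) (rule eq)
qed auto

lemma primitive_on_spike:
  assumes "primitive_on T f g" "negligible N" "\<And>t. t \<in> {0..T} - N \<Longrightarrow> h t = g t"
  shows "primitive_on T f h"
  using assms unfolding primitive_on_def
  by (auto intro!: has_integral_spike[of N _ h g])

lemma primitive_on_cong:
  assumes "\<And>t. t \<in> {0..T} \<Longrightarrow> f t = f' t" "\<And>t. t \<in> {0..T} \<Longrightarrow> g t = g' t"
  shows "primitive_on T f g \<longleftrightarrow> primitive_on T f' g'"
  unfolding primitive_on_def
proof (rule ball_cong[OF refl])
  fix t assume t: "t \<in> {0..T}"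
  then have "(g has_integral f t - f 0) {0..t} = (g' has_integral f t - f 0) {0..t}"
    using assms by (intro has_integral_cong) auto
  then show "(g has_integral f t - f 0) {0..t} = (g' has_integral f' t - f' 0) {0..t}"
    using assms(1)[of t] assms(1)[of 0] t by simp
qed

lemma primitive_on_continuous_iff:
  assumes "continuous_on {0..T} g"
  shows "primitive_on T f g \<longleftrightarrow>
    (\<forall>t\<in>{0..T}. (f has_real_derivative g t) (at t within {0..T}))" (is "_ \<longleftrightarrow> ?D")
proof
  assume P: "primitive_on T f g"
  show ?D
  proof
    fix t assume t: "t \<in> {0..T}"
    have "((\<lambda>t. f 0 + integral {0..t} g) has_real_derivative 0 + g t) (at t within {0..T})"
      by (intro derivative_intros integral_has_real_derivative assms t)
    then show "(f has_real_derivative g t) (at t within {0..T})"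
      using has_field_derivative_transform_within[OF _ zero_less_one t, of _ "g t" f]
        primitive_on_eq[OF P, symmetric] by simp
  qed
next
  assume D: ?D
  show "primitive_on T f g"
    unfolding primitive_on_def
  proof
    fix t assume "t \<in> {0..T}"
    then show "(g has_integral (f t - f 0)) {0..t}"
      using D
      by (intro fundamental_theorem_of_calculus)
         (auto simp flip: has_real_derivative_iff_has_vector_derivative
           intro: DERIV_subset[of _ _ _ "{0..T}"])
  qed
qed

lemma AE_lebesgue_on_iff_negligible:
  assumes "S \<in> sets lebesgue"
  shows "(AE t in lebesgue_on S. P t) \<longleftrightarrow> negligible {t \<in> S. \<not> P t}"
proof -
  have "(AE t in lebesgue_on S. P t) \<longleftrightarrow> (AE t in lebesgue. t \<in> S \<longrightarrow> P t)"
    using assms by (simp add: AE_restrict_space_iff)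
  also have "\<dots> \<longleftrightarrow> negligible {t \<in> S. \<not> P t}"
    by (simp add: completion.AE_iff_null_sets negligible_iff_null_sets)
  finally show ?thesis .
qed

lemma AE_lebesgue_on_Ioo_iff_negligible_Icc:
  "(AE t in lebesgue_on {0<..<T::real}. P t) \<longleftrightarrow> negligible {t \<in> {0..T}. \<not> P t}"
proof -
  have "negligible {t \<in> {0<..<T}. \<not> P t} \<longleftrightarrow> negligible {t \<in> {0..T}. \<not> P t}"
  proof
    assume "negligible {t \<in> {0<..<T}. \<not> P t}"
    then have "negligible ({t \<in> {0<..<T}. \<not> P t} \<union> {0, T})"
      by simp
    then show "negligible {t \<in> {0..T}. \<not> P t}"
      by (rule negligible_subset) auto
  qed (auto elim: negligible_subset)
  then show ?thesis
    by (simp add: AE_lebesgue_on_iff_negligible)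
qed

text \<open>Replaces an essentially bounded function by one that is bounded everywhere, so that pointwise
  estimates under the integral sign become available.\<close>

lemma Linfty_bounded_representative:
  assumes "Linfty {0<..<T} g"
  obtains N B h where "negligible N" "0 \<le> B" "\<And>t. \<bar>h t\<bar> \<le> B"
    "h absolutely_integrable_on {0..T}" "\<And>t. t \<in> {0..T} - N \<Longrightarrow> h t = g t"
proof -
  obtain B where B: "AE t in lebesgue_on {0<..<T}. \<bar>g t\<bar> \<le> B"
    and meas: "g \<in> borel_measurable (lebesgue_on {0<..<T})"
    using assms by (auto simp: Linfty_def)
  define h where "h t = (if t \<in> {0<..<T} then if \<bar>g t\<bar> \<le> B then g t else 0 else 0)" for t
  show thesis
  proof (rule that)
    show "negligible ({t \<in> {0..T}. \<not> \<bar>g t\<bar> \<le> B} \<union> {0, T})"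
      using B by (auto simp: AE_lebesgue_on_Ioo_iff_negligible_Icc)
    show "\<bar>h t\<bar> \<le> max 0 B" for t
      by (auto simp: h_def)
    have "(\<lambda>t. if \<bar>g t\<bar> \<le> B then g t else 0) \<in> borel_measurable (lebesgue_on {0<..<T})"
      using meas by measurable
    then have "h \<in> borel_measurable (lebesgue_on {0..T})"
      unfolding h_def by (subst borel_measurable_if_lebesgue_on) auto
    then show "h absolutely_integrable_on {0..T}"
      by (rule measurable_bounded_by_integrable_imp_absolutely_integrable[where g = "\<lambda>_. max 0 B"])
         (auto simp: h_def)
  qed (auto simp: h_def)
qed

lemma Linfty_absolutely_integrable:
  assumes "Linfty {0<..<T} g"
  shows "g absolutely_integrable_on {0..T}"
proof -
  obtain N h where "negligible N" "h absolutely_integrable_on {0..T}"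
    "\<And>t. t \<in> {0..T} - N \<Longrightarrow> h t = g t"
    using Linfty_bounded_representative[OF assms] by metis
  then show ?thesis
    by (metis absolutely_integrable_spike)
qed

lemma continuous_imp_Linfty:
  assumes "continuous_on {0..T::real} f"
  shows "Linfty {0<..<T} f"
proof -
  have "continuous_on {0<..<T} f"
    using assms by (rule continuous_on_subset) auto
  obtain B where "\<forall>t\<in>{0..T}. \<bar>f t\<bar> \<le> B"
    using compact_imp_bounded[OF compact_continuous_image[OF assms]]
    by (auto simp: bounded_iff)
  then have "negligible {t \<in> {0<..<T}. \<not> \<bar>f t\<bar> \<le> B}"
    by (intro negligible_subset[OF negligible_empty]) auto
  with \<open>continuous_on {0<..<T} f\<close> show ?thesis
    unfolding Linfty_def
    by (auto intro!: continuous_imp_measurable_on_sets_lebesgue exI[of _ B]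
        simp: AE_lebesgue_on_iff_negligible)
qed

lemma primitive_on_integral:
  assumes "Linfty {0<..<T} g"
  shows "primitive_on T (\<lambda>t. c + integral {0..t} g) g"
  unfolding primitive_on_def
proof
  fix t assume "t \<in> {0..T}"
  then have "g integrable_on {0..t}"
    using Linfty_absolutely_integrable[OF assms]
    by (auto intro: integrable_on_subinterval[of _ "{0..T}"] simp: absolutely_integrable_on_def)
  then show "(g has_integral c + integral {0..t} g - (c + integral {0..0} g)) {0..t}"
    by (simp add: has_integral_iff)
qed

text \<open>The estimate forces the derivative to vanish. It serves to show that an absolutely continuous
  function is constant without differentiating it almost everywhere.\<close>

lemma quadratic_increment_imp_constant:
  fixes H :: "real \<Rightarrow> real"
  assumes H: "\<And>s t. 0 \<le> s \<Longrightarrow> s \<le> t \<Longrightarrow> t \<le> T \<Longrightarrow> \<bar>H t - H s\<bar> \<le> C * (t - s)\<^sup>2"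
    and t: "t \<in> {0..T}"
  shows "H t = H 0"
proof -
  have "(H has_field_derivative 0) (at s within {0..T})" if s: "s \<in> {0..T}" for s
    unfolding has_field_derivative_iff
  proof (rule Lim_null_comparison)
    have "\<bar>(H r - H s) / (r - s)\<bar> \<le> C * \<bar>r - s\<bar>" if "r \<in> {0..T}" "r \<noteq> s" for r
    proof -
      have "\<bar>H r - H s\<bar> \<le> C * (r - s)\<^sup>2"
        using H[of r s] H[of s r] that s by (cases "r \<le> s") (auto simp: power2_commute abs_minus_commute)
      then show ?thesis
        using that by (simp add: abs_divide divide_le_eq power2_eq_square mult.assoc flip: abs_mult)
    qed
    then show "\<forall>\<^sub>F r in at s within {0..T}. norm ((H r - H s) / (r - s)) \<le> C * \<bar>r - s\<bar>"
      by (auto simp: eventually_at intro!: exI[of _ 1])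
    have "((\<lambda>r. C * \<bar>r - s\<bar>) \<longlongrightarrow> C * \<bar>s - s\<bar>) (at s within {0..T})"
      by (intro tendsto_intros)
    then show "((\<lambda>r. C * \<bar>r - s\<bar>) \<longlongrightarrow> 0) (at s within {0..T})"
      by simp
  qed
  then obtain c where "\<forall>s\<in>{0..T}. H s = c"
    using has_field_derivative_zero_constant[of "{0..T}" H] by auto
  then show ?thesis
    using t by simp
qed

text \<open>The difference \<open>H\<close> of both sides, as a function of the upper limit, has increment
  \<open>\<integral>\<^sub>s\<^sup>t g r (\<phi> t - \<phi> r) + (G s - G r) \<phi>' r dr\<close> over \<open>[s,t]\<close>. As \<open>G\<close> and \<open>\<phi>\<close> are Lipschitz, this is
  \<open>O((t - s)\<^sup>2)\<close>, and \<open>H\<close> is constant by \<open>quadratic_increment_imp_constant\<close>.\<close>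

lemma primitive_on_integration_by_parts:
  assumes Linf: "Linfty {0<..<T} g" and G: "primitive_on T G g" and T: "0 \<le> T"
    and phi: "\<And>t. t \<in> {0..T} \<Longrightarrow> (\<phi> has_real_derivative \<phi>' t) (at t within {0..T})"
    and cont: "continuous_on {0..T} \<phi>'"
  shows "((\<lambda>s. g s * \<phi> s + G s * \<phi>' s) has_integral (G T * \<phi> T - G 0 * \<phi> 0)) {0..T}"
proof -
  obtain N B h where N: "negligible N" and B: "0 \<le> B" "\<And>t. \<bar>h t\<bar> \<le> B"
    and h: "h absolutely_integrable_on {0..T}" and hg: "\<And>t. t \<in> {0..T} - N \<Longrightarrow> h t = g t"
    using Linfty_bounded_representative[OF Linf] by metis
  have Gh: "primitive_on T G h"
    using primitive_on_spike[OF G N hg] .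
  have contphi: "continuous_on {0..T} \<phi>"
    by (rule DERIV_continuous_on) (rule phi)
  have contG: "continuous_on {0..T} G"
    using G by (rule primitive_on_continuous)
  have prim_phi: "primitive_on T \<phi> \<phi>'"
    using phi cont by (simp add: primitive_on_continuous_iff)
  obtain D where D: "0 \<le> D" "\<And>t. t \<in> {0..T} \<Longrightarrow> \<bar>\<phi>' t\<bar> \<le> D"
  proof -
    obtain D where "\<forall>t\<in>{0..T}. \<bar>\<phi>' t\<bar> \<le> D"
      using compact_imp_bounded[OF compact_continuous_image[OF cont]] by (auto simp: bounded_iff)
    then show thesis
      using that[of D] T by force
  qed
  have lipG: "\<bar>G t - G s\<bar> \<le> B * (t - s)" if "0 \<le> s" "s \<le> t" "t \<le> T" for s t
    using has_integral_bound[of B h _ s t] primitive_on_increment[OF Gh that] B that by simp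
  have lipphi: "\<bar>\<phi> t - \<phi> s\<bar> \<le> D * (t - s)" if "0 \<le> s" "s \<le> t" "t \<le> T" for s t
    using has_integral_bound[of D \<phi>' _ s t] primitive_on_increment[OF prim_phi that] D that by simp
  let ?k = "\<lambda>s. h s * \<phi> s + G s * \<phi>' s"
  have "(\<lambda>s. \<phi> s * h s) absolutely_integrable_on {0..T}"
    using contphi h
    by (intro absolutely_integrable_bounded_measurable_product_real
        continuous_imp_measurable_on_sets_lebesgue compact_imp_bounded compact_continuous_image) auto
  then have "(\<lambda>s. h s * \<phi> s) integrable_on {0..T}"
    by (simp add: absolutely_integrable_on_def mult.commute)
  then have int: "?k integrable_on {0..T}"
    by (rule integrable_add) (intro integrable_continuous_real continuous_intros contG cont)
  define H where "H t = G t * \<phi> t - integral {0..t} ?k" for t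
  have "H T = H 0"
  proof (rule quadratic_increment_imp_constant)
    fix s t :: real assume st: "0 \<le> s" "s \<le> t" "t \<le> T"
    have intk: "?k integrable_on {0..t}" "?k integrable_on {s..t}"
      using int st by (auto intro: integrable_on_subinterval)
    have "((\<lambda>r. h r * \<phi> t + G s * \<phi>' r - ?k r) has_integral
        (G t - G s) * \<phi> t + G s * (\<phi> t - \<phi> s) - integral {s..t} ?k) {s..t}"
      by (rule has_integral_diff[OF has_integral_add[OF
            has_integral_mult_left[OF primitive_on_increment[OF Gh st]]
            has_integral_mult_right[OF primitive_on_increment[OF prim_phi st]]]
            integrable_integral[OF intk(2)]])
    moreover have "integral {0..s} ?k + integral {s..t} ?k = integral {0..t} ?k"
      using st intk by (intro Henstock_Kurzweil_Integration.integral_combine) auto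
    then have "(G t - G s) * \<phi> t + G s * (\<phi> t - \<phi> s) - integral {s..t} ?k = H t - H s"
      unfolding H_def left_diff_distrib right_diff_distrib by linarith
    ultimately have I: "((\<lambda>r. h r * \<phi> t + G s * \<phi>' r - ?k r) has_integral H t - H s) {s..t}"
      by (simp only:)
    have "norm (h r * \<phi> t + G s * \<phi>' r - ?k r) \<le> 2 * B * D * (t - s)" if r: "r \<in> {s..t}" for r
    proof -
      have "h r * \<phi> t + G s * \<phi>' r - ?k r = h r * (\<phi> t - \<phi> r) - (G r - G s) * \<phi>' r"
        by (simp add: algebra_simps)
      also have "norm \<dots> \<le> \<bar>h r\<bar> * \<bar>\<phi> t - \<phi> r\<bar> + \<bar>G r - G s\<bar> * \<bar>\<phi>' r\<bar>"
        using norm_triangle_ineq4[of "h r * (\<phi> t - \<phi> r)" "(G r - G s) * \<phi>' r"]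
        by (simp add: abs_mult)
      also have "\<dots> \<le> B * (D * (t - r)) + B * (r - s) * D"
        using B D r st lipG[of s r] lipphi[of r t] by (intro add_mono mult_mono) auto
      also have "\<dots> \<le> B * D * (t - s) + B * D * (t - s)"
        using B D r mult_left_mono[of "t - r" "t - s" "B * D"] mult_left_mono[of "r - s" "t - s" "B * D"]
        by (intro add_mono) (simp_all add: mult_ac)
      finally show ?thesis by simp
    qed
    then have "norm (H t - H s) \<le> 2 * B * D * (t - s) * measure lborel (cbox s t)"
      using I B D st by (intro has_integral_bound) auto
    then show "\<bar>H t - H s\<bar> \<le> 2 * B * D * (t - s)\<^sup>2"
      using st by (simp add: power2_eq_square mult.assoc)
  qed (use T in auto)
  then have "(?k has_integral (G T * \<phi> T - G 0 * \<phi> 0)) {0..T}"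
    using int by (simp add: H_def has_integral_iff)
  then show ?thesis
    by (rule has_integral_spike[OF N, rotated]) (simp add: hg)
qed

lemma LINT_open_interval:
  fixes f :: "real \<Rightarrow> real"
  assumes "f absolutely_integrable_on {0..T}"
  shows "integrable (lebesgue_on {0<..<T}) f"
    and "(LINT t|lebesgue_on {0<..<T}. f t) = integral {0..T} f"
proof -
  have "f absolutely_integrable_on {0<..<T}"
    using assms by (rule set_integrable_subset) auto
  then show *: "integrable (lebesgue_on {0<..<T}) f"
    by (simp add: set_integrable_def integrable_restrict_space)
  show "(LINT t|lebesgue_on {0<..<T}. f t) = integral {0..T} f"
    by (simp add: lebesgue_integral_eq_integral[OF *] integral_open_interval_real)
qed

lemma L1_loc_absolutely_integrable:
  assumes "f absolutely_integrable_on {0..T}"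
  shows "L1_loc T f"
  unfolding L1_loc_def
proof safe
  fix K :: "real set" assume K: "compact K" "K \<subseteq> {0<..<T}"
  then have "f absolutely_integrable_on K"
    by (intro set_integrable_subset[OF assms]) (auto simp: lmeasurable_compact fmeasurableD)
  then show "integrable (lebesgue_on K) f"
    using K by (simp add: set_integrable_def integrable_restrict_space lmeasurable_compact fmeasurableD)
qed

lemma test_functionD:
  assumes "test_function T \<phi>"
  shows "(\<phi> has_real_derivative deriv \<phi> t) (at t)" and "continuous_on UNIV (deriv \<phi>)"
    and "t \<le> 0 \<Longrightarrow> \<phi> t = 0" and "T \<le> t \<Longrightarrow> \<phi> t = 0"
proof -
  obtain D K where D: "\<And>t. (\<phi> has_vector_derivative D t) (at t)" and "continuous_on UNIV D"
    and K: "K \<subseteq> {0<..<T}" "\<And>t. t \<notin> K \<Longrightarrow> \<phi> t = 0"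
    using assms by (auto simp: test_function_def C1_differentiable_on_def)
  have D': "(\<phi> has_real_derivative D t) (at t)" for t
    using D by (simp add: has_real_derivative_iff_has_vector_derivative)
  have deriv: "deriv \<phi> = D"
    by (rule ext) (rule DERIV_imp_deriv[OF D'])
  show "(\<phi> has_real_derivative deriv \<phi> t) (at t)"
    using D' by (simp add: deriv)
  show "continuous_on UNIV (deriv \<phi>)"
    using \<open>continuous_on UNIV D\<close> by (simp add: deriv)
  show "\<phi> t = 0" if "t \<le> 0"
    using K(1) that by (intro K(2)) auto
  show "\<phi> t = 0" if "T \<le> t"
    using K(1) that by (intro K(2)) auto
qed

lemma primitive_on_test_function:
  assumes Linf: "Linfty {0<..<T} g" and f: "primitive_on T f g" and T: "0 < T"
    and phi: "test_function T \<phi>"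
  shows "(\<lambda>t. f t * deriv \<phi> t) absolutely_integrable_on {0..T}"
    and "(\<lambda>t. g t * \<phi> t) absolutely_integrable_on {0..T}"
    and "integral {0..T} (\<lambda>t. f t * deriv \<phi> t) = - integral {0..T} (\<lambda>t. g t * \<phi> t)"
proof -
  note der = test_functionD(1)[OF phi] and cont = test_functionD(2)[OF phi]
  have zero: "\<phi> 0 = 0" "\<phi> T = 0"
    using test_functionD(3,4)[OF phi] by auto
  have cont': "continuous_on {0..T} (deriv \<phi>)"
    using cont by (rule continuous_on_subset) simp
  have contphi: "continuous_on {0..T} \<phi>"
    using der by (intro DERIV_continuous_on) (auto intro: has_field_derivative_at_within)
  show 1: "(\<lambda>t. f t * deriv \<phi> t) absolutely_integrable_on {0..T}"
    by (intro absolutely_integrable_continuous_real continuous_intros cont'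
        primitive_on_continuous[OF f])
  have "(\<lambda>t. \<phi> t * g t) absolutely_integrable_on {0..T}"
    using Linfty_absolutely_integrable[OF Linf] contphi
    by (intro absolutely_integrable_bounded_measurable_product_real
        continuous_imp_measurable_on_sets_lebesgue compact_imp_bounded compact_continuous_image) auto
  then show 2: "(\<lambda>t. g t * \<phi> t) absolutely_integrable_on {0..T}"
    by (simp add: mult.commute)
  have "((\<lambda>t. g t * \<phi> t + f t * deriv \<phi> t) has_integral (f T * \<phi> T - f 0 * \<phi> 0)) {0..T}"
    by (rule primitive_on_integration_by_parts[OF Linf f less_imp_le[OF T] _ cont'])
       (rule has_field_derivative_at_within[OF der])
  then have "integral {0..T} (\<lambda>t. g t * \<phi> t + f t * deriv \<phi> t) = 0"
    using zero by (simp add: has_integral_iff)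
  moreover have "integral {0..T} (\<lambda>t. g t * \<phi> t + f t * deriv \<phi> t)
      = integral {0..T} (\<lambda>t. g t * \<phi> t) + integral {0..T} (\<lambda>t. f t * deriv \<phi> t)"
    using 1 2 by (intro integral_add) (auto simp: absolutely_integrable_on_def)
  ultimately show "integral {0..T} (\<lambda>t. f t * deriv \<phi> t) = - integral {0..T} (\<lambda>t. g t * \<phi> t)"
    by linarith
qed

lemma primitive_on_imp_weak_derivative:
  assumes Linf: "Linfty {0<..<T} g" and f: "primitive_on T f g" and T: "0 < T"
  shows "has_weak_derivative T f g"
  unfolding has_weak_derivative_def
proof (intro conjI allI impI)
  show "L1_loc T f"
    by (intro L1_loc_absolutely_integrable absolutely_integrable_continuous_real
        primitive_on_continuous[OF f])
  show "L1_loc T g"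
    by (intro L1_loc_absolutely_integrable Linfty_absolutely_integrable Linf)
  fix \<phi> assume phi: "test_function T \<phi>"
  show "(LINT t|lebesgue_on {0<..<T}. f t * deriv \<phi> t) = - (LINT t|lebesgue_on {0<..<T}. g t * \<phi> t)"
    using primitive_on_test_function[OF assms phi] by (simp add: LINT_open_interval)
qed

text \<open>With a cutoff \<open>\<eta>\<close> that is positive exactly on \<open>(a,b)\<close>, let \<open>c\<close> be the \<open>\<eta>\<close>-weighted mean of \<open>F\<close>. Then
  \<open>\<psi> = \<eta> (F - c)\<close> has mean zero, so its primitive \<open>\<phi>\<close> is a test function, and testing with it gives
  \<open>\<integral> \<eta> (F - c)\<^sup>2 = \<integral> F \<psi> - c \<integral> \<psi> = 0\<close>.\<close>

lemma du_bois_reymond: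
  fixes F :: "real \<Rightarrow> real"
  assumes contF: "continuous_on {0..T} F"
    and zero: "\<And>\<phi>. test_function T \<phi> \<Longrightarrow> integral {0..T} (\<lambda>t. F t * deriv \<phi> t) = 0"
    and ab: "0 < a" "a < b" "b < T"
  obtains c where "\<And>t. t \<in> {a<..<b} \<Longrightarrow> F t = c"
proof -
  \<comment> \<open>The test function has to be differentiable on all of \<open>\<real>\<close>, hence a continuous extension of \<open>F\<close>.\<close>
  define Fc where "Fc t = F (max 0 (min T t))" for t
  define \<eta> where "\<eta> t = max 0 ((t - a) * (b - t))" for t :: real
  have contFc: "continuous_on S Fc" for S
    unfolding Fc_def
    by (rule continuous_on_compose2[OF contF]) (use ab in \<open>auto intro!: continuous_intros\<close>)
  have conteta: "continuous_on S \<eta>" for S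
    unfolding \<eta>_def by (intro continuous_intros)
  have eta_out: "\<eta> t = 0" if "t \<notin> {a<..<b}" for t
    using that ab unfolding \<eta>_def
    by (auto simp: max_def zero_le_mult_iff not_less mult_le_0_iff)
  have eta_in: "0 < \<eta> t" if "t \<in> {a<..<b}" for t
    using that unfolding \<eta>_def by simp
  have eta_nonneg: "0 \<le> \<eta> t" for t
    by (simp add: \<eta>_def)
  define c where "c = integral {0..T} (\<lambda>t. \<eta> t * Fc t) / integral {0..T} \<eta>"
  define \<psi> where "\<psi> t = \<eta> t * (Fc t - c)" for t
  have contpsi: "continuous_on S \<psi>" for S
    unfolding \<psi>_def by (intro continuous_intros contFc conteta)
  have psi_out: "\<psi> t = 0" if "t \<notin> {a<..<b}" for t
    using eta_out[OF that] by (simp add: \<psi>_def)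
  have "integral {0..T} \<eta> \<noteq> 0"
    using integral_eq_0_iff[of 0 T \<eta>] conteta eta_nonneg eta_in[of "(a + b) / 2"] ab
    by force
  then have int0: "integral {0..T} \<psi> = 0"
    unfolding \<psi>_def right_diff_distrib
    by (subst integral_diff)
       (auto intro!: integrable_continuous_real continuous_intros contFc conteta simp: c_def)
  define \<phi> where "\<phi> t = integral {0..t} \<psi>" for t
  have phi_left: "\<phi> t = 0" if "t \<le> a" for t
  proof -
    have "integral {0..t} \<psi> = integral {0..t} (\<lambda>_. 0)"
      using that by (intro Henstock_Kurzweil_Integration.integral_cong psi_out) auto
    then show ?thesis by (simp add: \<phi>_def)
  qed
  have phi_const: "\<phi> t = \<phi> b" if "b \<le> t" for t
  proof -
    have "integral {b..t} \<psi> = integral {b..t} (\<lambda>_. 0)"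
      using that by (intro Henstock_Kurzweil_Integration.integral_cong psi_out) auto
    moreover have "integral {0..b} \<psi> + integral {b..t} \<psi> = integral {0..t} \<psi>"
      using that ab
      by (intro Henstock_Kurzweil_Integration.integral_combine integrable_continuous_real contpsi) auto
    ultimately show ?thesis by (simp add: \<phi>_def)
  qed
  have phi_right: "\<phi> t = 0" if "b \<le> t" for t
    using phi_const[OF that] phi_const[of T] int0 ab by (simp add: \<phi>_def)
  have der: "(\<phi> has_real_derivative \<psi> t) (at t)" for t
  proof (cases "t < a")
    case True
    have "((\<lambda>_. 0) has_real_derivative 0) (at t)" by simp
    then have "(\<phi> has_real_derivative 0) (at t)"
      by (rule has_field_derivative_transform_within_open[where S = "{..<a}"])
         (use True phi_left in auto)
    then show ?thesis
      using psi_out[of t] True by simp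
  next
    case False
    then have "(\<phi> has_real_derivative \<psi> t) (at t within {0..t + 1})"
      unfolding \<phi>_def using ab by (intro integral_has_real_derivative contpsi) auto
    then show ?thesis
      using False ab by (simp add: at_within_Icc_at)
  qed
  have deriv: "deriv \<phi> = \<psi>"
    by (rule ext) (rule DERIV_imp_deriv[OF der])
  have "test_function T \<phi>"
    unfolding test_function_def C1_differentiable_on_def
  proof (intro conjI exI)
    show "\<forall>t\<in>UNIV. (\<phi> has_vector_derivative \<psi> t) (at t)"
      using der by (simp add: has_real_derivative_iff_has_vector_derivative)
    show "compact {a..b}" "{a..b} \<subseteq> {0<..<T}"
      using ab by auto
    show "\<forall>t. t \<notin> {a..b} \<longrightarrow> \<phi> t = 0"
      using phi_left phi_right by force
  qed (rule contpsi)
  from zero[OF this] have "integral {0..T} (\<lambda>t. Fc t * \<psi> t) = 0"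
    unfolding deriv
    by (subst Henstock_Kurzweil_Integration.integral_cong[where g = "\<lambda>t. F t * \<psi> t"]) (auto simp: Fc_def)
  moreover have "integral {0..T} (\<lambda>t. \<eta> t * (Fc t - c)\<^sup>2)
      = integral {0..T} (\<lambda>t. Fc t * \<psi> t - c * \<psi> t)"
    by (intro Henstock_Kurzweil_Integration.integral_cong) (simp add: \<psi>_def power2_eq_square algebra_simps)
  ultimately have "integral {0..T} (\<lambda>t. \<eta> t * (Fc t - c)\<^sup>2) = 0"
    using int0
    by (subst (asm) integral_diff)
       (auto intro!: integrable_continuous_real continuous_intros contFc contpsi)
  moreover have "continuous_on {0..T} (\<lambda>t. \<eta> t * (Fc t - c)\<^sup>2)"
    by (intro continuous_intros contFc conteta)
  ultimately have *: "\<eta> t * (Fc t - c)\<^sup>2 = 0" if "t \<in> {0..T}" for t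
    using integral_eq_0_iff[of 0 T "\<lambda>t. \<eta> t * (Fc t - c)\<^sup>2"] that ab eta_nonneg by simp
  show thesis
  proof (rule that)
    fix t assume t: "t \<in> {a<..<b}"
    then show "F t = c"
      using *[of t] eta_in[OF t] ab by (auto simp: Fc_def)
  qed
qed

text \<open>The bridge between weak and classical solutions; the left-hand side has the shape in which the
  equations of motion occur in the definition of a solution. For the direction from left to right,
  \<open>F = f - \<integral> g\<close> has weak derivative zero and is constant by \<open>du_bois_reymond\<close>.\<close>

lemma weak_derivative_iff_primitive:
  assumes T: "0 < T" and contf: "continuous_on {0..T} f" and Linf: "Linfty {0<..<T} g"
  shows "(\<exists>g'. has_weak_derivative T f g' \<and> (AE t in lebesgue_on {0..T}. g' t = g t))
    \<longleftrightarrow> primitive_on T f g"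
proof
  assume "primitive_on T f g"
  then show "\<exists>g'. has_weak_derivative T f g' \<and> (AE t in lebesgue_on {0..T}. g' t = g t)"
    using primitive_on_imp_weak_derivative[OF Linf _ T] by auto
next
  assume "\<exists>g'. has_weak_derivative T f g' \<and> (AE t in lebesgue_on {0..T}. g' t = g t)"
  then obtain g' where g': "has_weak_derivative T f g'" and ae: "AE t in lebesgue_on {0..T}. g' t = g t"
    by blast
  define G where "G t = 0 + integral {0..t} g" for t
  have G: "primitive_on T G g"
    unfolding G_def by (rule primitive_on_integral[OF Linf])
  define F where "F t = f t - G t" for t
  have contF: "continuous_on {0..T} F"
    unfolding F_def by (intro continuous_intros contf primitive_on_continuous[OF G])
  have zero: "integral {0..T} (\<lambda>t. F t * deriv \<phi> t) = 0" if phi: "test_function T \<phi>" for \<phi>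
  proof -
    note pt = primitive_on_test_function[OF Linf G T phi]
    have "continuous_on {0..T} (deriv \<phi>)"
      using test_functionD(2)[OF phi] by (rule continuous_on_subset) simp
    then have f_phi: "(\<lambda>t. f t * deriv \<phi> t) absolutely_integrable_on {0..T}"
      by (intro absolutely_integrable_continuous_real continuous_intros contf)
    have neg: "negligible {t \<in> {0..T}. \<not> g' t = g t}"
      using ae by (simp add: AE_lebesgue_on_iff_negligible)
    have "(\<lambda>t. g' t * \<phi> t) absolutely_integrable_on {0..T}"
      by (rule absolutely_integrable_spike[OF pt(2) neg]) auto
    moreover have weak: "(LINT t|lebesgue_on {0<..<T}. f t * deriv \<phi> t)
        = - (LINT t|lebesgue_on {0<..<T}. g' t * \<phi> t)"
      using g' phi by (simp add: has_weak_derivative_def)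
    moreover have "integral {0..T} (\<lambda>t. g t * \<phi> t) = integral {0..T} (\<lambda>t. g' t * \<phi> t)"
      by (rule integral_spike[OF neg]) auto
    ultimately have "integral {0..T} (\<lambda>t. f t * deriv \<phi> t) = - integral {0..T} (\<lambda>t. g t * \<phi> t)"
      using weak f_phi by (simp add: LINT_open_interval)
    then show ?thesis
      unfolding F_def left_diff_distrib using pt f_phi
      by (subst integral_diff) (auto simp: absolutely_integrable_on_def)
  qed
  have const: "F t = F (T / 2)" if t: "t \<in> {0<..<T}" for t
  proof -
    define a where "a = min t (T / 2) / 2"
    define b where "b = (T + max t (T / 2)) / 2"
    have ab: "0 < a" "a < b" "b < T" "t \<in> {a<..<b}" "T / 2 \<in> {a<..<b}"
      using t by (auto simp: a_def b_def min_def max_def)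
    obtain c where "\<And>s. s \<in> {a<..<b} \<Longrightarrow> F s = c"
      using du_bois_reymond[OF contF zero ab(1-3)] by blast
    then show ?thesis
      using ab(4,5) by simp
  qed
  have const': "F t = F (T / 2)" if "t \<in> {0..T}" for t
    by (rule continuous_constant_on_closure[of "{0<..<T}"]) (use contF that T in simp, rule const, use that T in simp_all)
  show "primitive_on T f g"
    unfolding primitive_on_def
  proof
    fix t assume t: "t \<in> {0..T}"
    have "f t - f 0 = G t - G 0"
      using const'[OF t] const'[of 0] T unfolding F_def by simp
    then show "(g has_integral (f t - f 0)) {0..t}"
      using G t by (simp add: primitive_on_def)
  qed
qed

lemma sobolev_inf_1:
  assumes "0 < T" "Linfty {0<..<T} g" "primitive_on T f g"
  shows "sobolev_inf 1 T f"
  using primitive_on_imp_weak_derivative[of T g f] continuous_imp_Linfty[OF primitive_on_continuous] assms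
  by auto

lemma sobolev_inf_2:
  assumes "0 < T" "primitive_on T f g" "sobolev_inf 1 T g"
  shows "sobolev_inf 2 T f"
  using primitive_on_imp_weak_derivative[of T g f] continuous_imp_Linfty[OF primitive_on_continuous] assms
  by (auto simp: numeral_2_eq_2)

lemma LINT_eq_integral:
  assumes "Linfty {0<..<T} g" "t \<in> {0..T}"
  shows "(LINT s|lebesgue_on {0..t}. g s) = integral {0..t} g"
proof -
  have "g absolutely_integrable_on {0..t}"
    using Linfty_absolutely_integrable[OF assms(1)] assms(2)
    by (auto intro: absolutely_integrable_on_subinterval)
  then have "integrable (lebesgue_on {0..t}) g"
    by (simp add: set_integrable_def integrable_restrict_space)
  then show ?thesis
    by (simp add: lebesgue_integral_eq_integral)
qed

lemma primitive_on_mono: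
  assumes "primitive_on T f g" "\<And>t. t \<in> {0..T} \<Longrightarrow> 0 \<le> g t" "t \<in> {0..T}"
  shows "f 0 \<le> f t"
  using has_integral_nonneg[of g "f t - f 0" "{0..t}"] assms by (auto simp: primitive_on_def)

lemma primitive_on_unique:
  assumes "primitive_on T f g" "primitive_on T f' g" "f 0 = f' 0" "t \<in> {0..T}"
  shows "f t = f' t"
  using has_integral_unique[of g "f t - f 0" "{0..t}" "f' t - f' 0"] assms
  by (auto simp: primitive_on_def)

section \<open>A single vehicle following its leader\<close>

text \<open>For a continuous function an essential bound is a bound everywhere, because nonempty open sets
  are not negligible.\<close>

lemma AE_bounded_continuous_imp_bounded:
  fixes V :: "real \<Rightarrow> real"
  assumes "Linfty {0..} V" and cont: "continuous_on {0<..} V"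
  obtains K where "\<And>s. 0 < s \<Longrightarrow> \<bar>V s\<bar> \<le> K"
proof -
  obtain K where K: "AE t in lebesgue_on {0..}. \<bar>V t\<bar> \<le> K"
    using assms(1) by (auto simp: Linfty_def)
  define S where "S = {0<..} \<inter> (\<lambda>s. \<bar>V s\<bar>) -` {K<..}"
  have "open S"
    unfolding S_def by (intro continuous_open_preimage continuous_intros cont open_greaterThan)
  moreover have "negligible S"
    using K unfolding S_def
    by (simp add: AE_lebesgue_on_iff_negligible) (erule negligible_subset, auto)
  ultimately have "S = {}"
    using open_not_negligible by blast
  then show thesis
    using that[of K] by (force simp: S_def)
qed

lemma lipschitz_pos_reals_Icc:
  fixes V :: "real \<Rightarrow> real"
  assumes "V C1_differentiable_on {0<..}" and c: "0 < c"
  obtains L where "0 \<le> L"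
    "\<And>r s. r \<in> {c..C} \<Longrightarrow> s \<in> {c..C} \<Longrightarrow> \<bar>V r - V s\<bar> \<le> L * \<bar>r - s\<bar>"
proof -
  obtain D where D: "\<And>s. 0 < s \<Longrightarrow> (V has_vector_derivative D s) (at s)"
    and contD: "continuous_on {0<..} D"
    using assms(1) by (auto simp: C1_differentiable_on_def)
  have "continuous_on {c..C} D"
    using c by (intro continuous_on_subset[OF contD]) auto
  then obtain L where L: "\<forall>s\<in>{c..C}. \<bar>D s\<bar> \<le> L"
    using compact_imp_bounded[OF compact_continuous_image] by (fastforce simp: bounded_iff)
  show thesis
  proof (rule that[of "max 0 L"])
    fix r s assume rs: "r \<in> {c..C}" "s \<in> {c..C}"
    have "norm (V r - V s) \<le> max 0 L * norm (r - s)"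
    proof (rule field_differentiable_bound[OF convex_real_interval(5)])
      fix x assume x: "x \<in> {c..C}"
      then show "(V has_field_derivative D x) (at x within {c..C})"
        using D[of x] c
        by (auto simp: has_real_derivative_iff_has_vector_derivative intro: has_vector_derivative_at_within)
      show "norm (D x) \<le> max 0 L"
        using L x by fastforce
    qed (use rs in auto)
    then show "\<bar>V r - V s\<bar> \<le> max 0 L * \<bar>r - s\<bar>"
      by simp
  qed simp
qed

text \<open>A human driver seen from the leader with velocity \<open>w\<close>: only the gap \<open>h\<close> and the own velocity
  \<open>v\<close> enter.\<close>

definition gap_system ::
  "real \<Rightarrow> real \<Rightarrow> (real \<Rightarrow> real) \<Rightarrow> real \<Rightarrow> (real \<Rightarrow> real) \<Rightarrow> (real \<Rightarrow> real) \<Rightarrow> (real \<Rightarrow> real) \<Rightarrow> bool" where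
  "gap_system \<alpha> \<beta> V \<tau> w h v \<longleftrightarrow> (\<forall>t\<in>{0..\<tau>}.
     (h has_real_derivative w t - v t) (at t within {0..\<tau>}) \<and>
     (v has_real_derivative \<alpha> * (V (h t) - v t) + \<beta> * ((w t - v t) / (h t)\<^sup>2)) (at t within {0..\<tau>}) \<and>
     0 < h t)"

text \<open>The right-hand side in the variables \<open>z = (h, v + \<beta>/h)\<close>, where \<open>h\<close> is replaced by its nearest
  point \<open>k\<close> in \<open>[c,C]\<close>. In the variables \<open>(h, v)\<close> the product \<open>v/h\<^sup>2\<close> would spoil the global
  Lipschitz condition.\<close>

definition clamped_field ::
  "real \<Rightarrow> real \<Rightarrow> (real \<Rightarrow> real) \<Rightarrow> real \<Rightarrow> real \<Rightarrow> (real \<Rightarrow> real) \<Rightarrow> real \<Rightarrow> real \<times> real \<Rightarrow> real \<times> real" where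
  "clamped_field \<alpha> \<beta> V c C w t z = (let k = max c (min C (fst z)) in
     (w t - snd z + \<beta> / k, \<alpha> * (V k - snd z + \<beta> / k)))"

locale bando_ftl =
  fixes \<alpha> \<beta> l K :: real and V :: "real \<Rightarrow> real"
  assumes alpha: "0 < \<alpha>" and beta: "0 < \<beta>"
    and V_C1: "V C1_differentiable_on {0<..}"
    and V_nonneg: "\<And>s. 0 < s \<Longrightarrow> 0 \<le> V s"
    and V_le: "\<And>s. 0 < s \<Longrightarrow> V s \<le> K"
begin

lemma K_nonneg: "0 \<le> K"
  using V_nonneg[of 1] V_le[of 1] by simp

text \<open>The equation reads \<open>v' + a v = \<alpha> V(h) + \<beta> w/h\<^sup>2\<close> with \<open>a = \<alpha> + \<beta>/h\<^sup>2\<close>. Its right-hand side is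
  nonnegative, so \<open>exp (\<integral> a) v\<close> is nondecreasing.\<close>

lemma gap_system_velocity_nonneg:
  assumes sys: "gap_system \<alpha> \<beta> V \<tau> w h v"
    and w: "\<And>t. t \<in> {0..\<tau>} \<Longrightarrow> 0 \<le> w t" and v0: "0 \<le> v 0" and t: "t \<in> {0..\<tau>}"
  shows "0 \<le> v t"
proof -
  have dh: "(h has_real_derivative w t - v t) (at t within {0..\<tau>})"
    and dv: "(v has_real_derivative \<alpha> * (V (h t) - v t) + \<beta> * ((w t - v t) / (h t)\<^sup>2)) (at t within {0..\<tau>})"
    and h: "0 < h t" if "t \<in> {0..\<tau>}" for t
    using sys that by (auto simp: gap_system_def)
  have conth: "continuous_on {0..\<tau>} h"
    by (rule DERIV_continuous_on) (rule dh)
  define a where "a t = \<alpha> + \<beta> / (h t)\<^sup>2" for t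
  define A where "A t = integral {0..t} a" for t
  have conta: "continuous_on {0..\<tau>} a"
    unfolding a_def using h by (force intro!: continuous_intros conth)
  have dA: "(A has_real_derivative a t) (at t within {0..\<tau>})" if "t \<in> {0..\<tau>}" for t
    unfolding A_def by (rule integral_has_real_derivative[OF conta that])
  define E' where "E' t = exp (A t) * (\<alpha> * V (h t) + \<beta> * (w t / (h t)\<^sup>2))" for t
  have "exp (A 0) * v 0 \<le> exp (A t) * v t"
  proof (rule deriv_nonneg_imp_le[where f = "\<lambda>t. exp (A t) * v t" and f' = E' and T = \<tau>])
    fix s assume s: "s \<in> {0..\<tau>}"
    have "((\<lambda>t. exp (A t) * v t) has_real_derivative
        exp (A s) * a s * v s +
        (\<alpha> * (V (h s) - v s) + \<beta> * ((w s - v s) / (h s)\<^sup>2)) * exp (A s)) (at s within {0..\<tau>})"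
      by (rule DERIV_mult[OF DERIV_chain2[OF DERIV_exp dA[OF s]] dv[OF s]])
    moreover have "exp (A s) * a s * v s +
        (\<alpha> * (V (h s) - v s) + \<beta> * ((w s - v s) / (h s)\<^sup>2)) * exp (A s) = E' s"
      by (simp add: E'_def a_def algebra_simps diff_divide_distrib)
    ultimately show "((\<lambda>t. exp (A t) * v t) has_real_derivative E' s) (at s within {0..\<tau>})"
      by simp
    show "0 \<le> E' s"
      using alpha beta V_nonneg[OF h[OF s]] w[OF s] by (simp add: E'_def)
  qed (use t in auto)
  moreover have "0 \<le> exp (A 0) * v 0"
    using v0 by simp
  ultimately have "0 \<le> exp (A t) * v t"
    by linarith
  then show ?thesis
    by (simp add: zero_le_mult_iff)
qed

text \<open>The singular terms cancel in \<open>(v + \<beta>/h)' = \<alpha> (V(h) - v) \<le> \<alpha> K\<close>. With \<open>v \<ge> 0\<close> this is a positive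
  lower bound on \<open>h\<close>: no collision can occur.\<close>

lemma gap_system_potential_bound:
  assumes sys: "gap_system \<alpha> \<beta> V \<tau> w h v"
    and w: "\<And>t. t \<in> {0..\<tau>} \<Longrightarrow> 0 \<le> w t" and v0: "0 \<le> v 0" and t: "t \<in> {0..\<tau>}"
  shows "v t + \<beta> / h t \<le> v 0 + \<beta> / h 0 + \<alpha> * K * t"
proof -
  have dh: "(h has_real_derivative w t - v t) (at t within {0..\<tau>})"
    and dv: "(v has_real_derivative \<alpha> * (V (h t) - v t) + \<beta> * ((w t - v t) / (h t)\<^sup>2)) (at t within {0..\<tau>})"
    and h: "0 < h t" if "t \<in> {0..\<tau>}" for t
    using sys that by (auto simp: gap_system_def)
  define P where "P t = \<alpha> * K * t - (v t + \<beta> / h t)" for t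
  have "P 0 \<le> P t"
  proof (rule deriv_nonneg_imp_le[where f = P and f' = "\<lambda>s. \<alpha> * (K - V (h s) + v s)" and T = \<tau>])
    fix s assume s: "s \<in> {0..\<tau>}"
    show "(P has_real_derivative \<alpha> * (K - V (h s) + v s)) (at s within {0..\<tau>})"
      unfolding P_def using h[OF s]
      by (auto intro!: derivative_eq_intros dh[OF s] dv[OF s])
         (simp add: field_simps power2_eq_square)
    show "0 \<le> \<alpha> * (K - V (h s) + v s)"
      using alpha V_le[OF h[OF s]] gap_system_velocity_nonneg[OF sys w v0 s] by simp
  qed (use t in auto)
  then show ?thesis
    by (simp add: P_def)
qed

lemma clamped_field_lipschitz:
  assumes c: "0 < c" "c \<le> C"
  obtains L where "0 < L"
    "\<And>w t z z'. norm (clamped_field \<alpha> \<beta> V c C w t z - clamped_field \<alpha> \<beta> V c C w t z') \<le> L * norm (z - z')"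
proof -
  obtain L where L: "0 \<le> L"
    "\<And>r s. r \<in> {c..C} \<Longrightarrow> s \<in> {c..C} \<Longrightarrow> \<bar>V r - V s\<bar> \<le> L * \<bar>r - s\<bar>"
    using lipschitz_pos_reals_Icc[OF V_C1 c(1)] by metis
  define D where "D = \<beta> / (c * c)"
  have D: "0 \<le> D" "\<bar>\<beta> / r - \<beta> / s\<bar> \<le> D * \<bar>r - s\<bar>" if "c \<le> r" "c \<le> s" for r s
  proof -
    show "0 \<le> D" using beta c by (simp add: D_def)
    have "\<beta> / r - \<beta> / s = \<beta> * (s - r) / (r * s)"
      using that c by (simp add: field_simps)
    also have "\<bar>\<dots>\<bar> = \<beta> * \<bar>r - s\<bar> / (r * s)"
      using that c beta by (simp add: abs_mult abs_minus_commute)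
    also have "\<dots> \<le> \<beta> * \<bar>r - s\<bar> / (c * c)"
      using that c beta by (intro divide_left_mono mult_mono) auto
    finally show "\<bar>\<beta> / r - \<beta> / s\<bar> \<le> D * \<bar>r - s\<bar>"
      by (simp add: D_def)
  qed
  define B where "B = (1 + D) + \<alpha> * (L + 1 + D)"
  show thesis
  proof (rule that[of B])
    show "0 < B"
      using L D(1)[of c c] alpha by (auto simp: B_def intro!: add_pos_nonneg)
  next
    fix w :: "real \<Rightarrow> real" and t :: real and z z' :: "real \<times> real"
    define k k' where "k = max c (min C (fst z))" and "k' = max c (min C (fst z'))"
    define d where "d = norm (z - z')"
    have k: "k \<in> {c..C}" "k' \<in> {c..C}"
      using c by (auto simp: k_def k'_def)
    have z1: "\<bar>fst z - fst z'\<bar> \<le> d" and z2: "\<bar>snd z - snd z'\<bar> \<le> d"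
      using norm_fst_le[of "fst z - fst z'" "snd z - snd z'"]
        norm_snd_le[of "snd z - snd z'" "fst z - fst z'"]
      by (simp_all add: d_def minus_prod_def)
    have "\<bar>k - k'\<bar> \<le> \<bar>fst z - fst z'\<bar>"
      by (auto simp: k_def k'_def)
    with z1 have kd: "\<bar>k - k'\<bar> \<le> d" by simp
    have V: "\<bar>V k - V k'\<bar> \<le> L * d"
      using L(2)[OF k] mult_left_mono[OF kd L(1)] by linarith
    have b: "\<bar>\<beta> / k - \<beta> / k'\<bar> \<le> D * d"
      using D(2)[of k k'] mult_left_mono[OF kd D(1)[of c c]] k by simp
    have 1: "\<bar>- (snd z - snd z') + (\<beta> / k - \<beta> / k')\<bar> \<le> (1 + D) * d"
      using z2 b by (simp add: distrib_right)
    have "\<bar>(V k - V k') - (snd z - snd z') + (\<beta> / k - \<beta> / k')\<bar> \<le> (L + 1 + D) * d"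
      using z2 b V by (simp add: distrib_right)
    then have 2: "\<bar>\<alpha> * ((V k - V k') - (snd z - snd z') + (\<beta> / k - \<beta> / k'))\<bar> \<le> \<alpha> * (L + 1 + D) * d"
      using alpha by (simp add: abs_mult)
    have "clamped_field \<alpha> \<beta> V c C w t z - clamped_field \<alpha> \<beta> V c C w t z'
        = (- (snd z - snd z') + (\<beta> / k - \<beta> / k'),
           \<alpha> * ((V k - V k') - (snd z - snd z') + (\<beta> / k - \<beta> / k')))"
      by (simp add: clamped_field_def Let_def k_def k'_def algebra_simps)
    also have "norm \<dots> \<le> (1 + D) * d + \<alpha> * (L + 1 + D) * d"
      using 1 2 norm_Pair_le by (smt (verit) real_norm_def)
    finally show "norm (clamped_field \<alpha> \<beta> V c C w t z - clamped_field \<alpha> \<beta> V c C w t z') \<le> B * norm (z - z')"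
      by (simp add: B_def d_def distrib_right)
  qed
qed

lemma continuous_on_clamped_field:
  assumes "0 < c" "continuous_on {0..T} w" "continuous_on {0..T} z"
  shows "continuous_on {0..T} (\<lambda>t. clamped_field \<alpha> \<beta> V c C w t (z t))"
proof -
  have k: "continuous_on {0..T} (\<lambda>t. max c (min C (fst (z t))))"
    by (intro continuous_intros assms)
  moreover have "continuous_on {0..T} (\<lambda>t. V (max c (min C (fst (z t)))))"
    by (rule continuous_on_compose2[OF C1_differentiable_imp_continuous_on[OF V_C1] k])
       (use \<open>0 < c\<close> in auto)
  ultimately show ?thesis
    unfolding clamped_field_def Let_def using \<open>0 < c\<close>
    by (intro continuous_intros assms) (auto simp: max_def split: if_splits)
qed

lemma gap_system_imp_clamped_field:
  assumes sys: "gap_system \<alpha> \<beta> V T w h v"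
    and c: "\<And>t. t \<in> {0..T} \<Longrightarrow> h t \<in> {c..C}" and t: "t \<in> {0..T}"
  shows "((\<lambda>t. (h t, v t + \<beta> / h t)) has_vector_derivative
      clamped_field \<alpha> \<beta> V c C w t (h t, v t + \<beta> / h t)) (at t within {0..T})"
proof -
  have dh: "(h has_real_derivative w t - v t) (at t within {0..T})"
    and dv: "(v has_real_derivative \<alpha> * (V (h t) - v t) + \<beta> * ((w t - v t) / (h t)\<^sup>2)) (at t within {0..T})"
    and h: "0 < h t"
    using sys t by (auto simp: gap_system_def)
  have dp: "((\<lambda>t. v t + \<beta> / h t) has_real_derivative \<alpha> * (V (h t) - v t)) (at t within {0..T})"
    using h by (auto intro!: derivative_eq_intros dh dv) (simp add: field_simps power2_eq_square)
  have "max c (min C (h t)) = h t"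
    using c[OF t] by simp
  then have "clamped_field \<alpha> \<beta> V c C w t (h t, v t + \<beta> / h t) = (w t - v t, \<alpha> * (V (h t) - v t))"
    by (simp add: clamped_field_def)
  then show ?thesis
    using has_vector_derivative_Pair[OF dh[unfolded has_real_derivative_iff_has_vector_derivative]
        dp[unfolded has_real_derivative_iff_has_vector_derivative]] by simp
qed

lemma clamped_field_imp_gap_system:
  assumes z: "\<And>t. t \<in> {0..\<tau>} \<Longrightarrow>
      (z has_vector_derivative clamped_field \<alpha> \<beta> V c C w t (z t)) (at t within {0..\<tau>})"
    and c: "0 < c" "\<And>t. t \<in> {0..\<tau>} \<Longrightarrow> fst (z t) \<in> {c..C}"
  shows "gap_system \<alpha> \<beta> V \<tau> w (\<lambda>t. fst (z t)) (\<lambda>t. snd (z t) - \<beta> / fst (z t))"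
  unfolding gap_system_def
proof
  fix t assume t: "t \<in> {0..\<tau>}"
  define h v where "h t = fst (z t)" and "v t = snd (z t) - \<beta> / fst (z t)" for t
  have h: "0 < h t" using c t by (force simp: h_def)
  have "max c (min C (fst (z t))) = h t"
    using c t by (simp add: h_def)
  then have F: "clamped_field \<alpha> \<beta> V c C w t (z t) = (w t - v t, \<alpha> * (V (h t) - v t))"
    by (simp add: clamped_field_def v_def h_def Let_def algebra_simps)
  have dh: "(h has_real_derivative w t - v t) (at t within {0..\<tau>})"
    using bounded_linear.has_vector_derivative[OF bounded_linear_fst z[OF t]]
    by (simp add: F has_real_derivative_iff_has_vector_derivative h_def[abs_def])
  have dp: "((\<lambda>t. snd (z t)) has_real_derivative \<alpha> * (V (h t) - v t)) (at t within {0..\<tau>})"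
    using bounded_linear.has_vector_derivative[OF bounded_linear_snd z[OF t]]
    by (simp add: F has_real_derivative_iff_has_vector_derivative)
  have "((\<lambda>t. snd (z t) - \<beta> / h t) has_real_derivative
      \<alpha> * (V (h t) - v t) + \<beta> * ((w t - v t) / (h t)\<^sup>2)) (at t within {0..\<tau>})"
    using h by (auto intro!: derivative_eq_intros dh dp) (simp add: field_simps power2_eq_square)
  then show "((\<lambda>t. fst (z t)) has_real_derivative w t - (snd (z t) - \<beta> / fst (z t))) (at t within {0..\<tau>}) \<and>
     ((\<lambda>t. snd (z t) - \<beta> / fst (z t)) has_real_derivative
       \<alpha> * (V (fst (z t)) - (snd (z t) - \<beta> / fst (z t))) +
       \<beta> * ((w t - (snd (z t) - \<beta> / fst (z t))) / (fst (z t))\<^sup>2)) (at t within {0..\<tau>}) \<and>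
     0 < fst (z t)"
    using dh h by (simp add: h_def[abs_def] v_def)
qed

text \<open>The a priori bounds hold with room to spare: as long as the gap of the clamped solution lies in
  \<open>[c,C]\<close>, it solves the true system and lies in fact in \<open>(c,C)\<close> (fact \<open>strict\<close>). At the first time
  where it fails to lie in \<open>(c,C)\<close> this is a contradiction.\<close>

lemma gap_system_exists:
  assumes T: "0 \<le> T" and contw: "continuous_on {0..T} w"
    and w: "\<And>t. t \<in> {0..T} \<Longrightarrow> 0 \<le> w t" and v0: "0 \<le> v0" and h0: "0 < h0"
  obtains h v where "gap_system \<alpha> \<beta> V T w h v" "h 0 = h0" "v 0 = v0"
proof -
  define P where "P = v0 + \<beta> / h0 + \<alpha> * K * T"
  have P0: "\<beta> / h0 \<le> P"
    using v0 alpha K_nonneg T by (simp add: P_def)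
  moreover have "0 < \<beta> / h0"
    using beta h0 by simp
  ultimately have Ppos: "0 < P" by linarith
  \<comment> \<open>The potential stays below \<open>P\<close>, so the gap stays above \<open>\<beta>/P\<close>; \<open>c\<close> is strictly smaller.\<close>
  define c where "c = \<beta> / (P + 1)"
  have c: "0 < c" using beta Ppos by (simp add: c_def)
  have above_c: "c < r" if "\<beta> / r \<le> P" "0 < r" for r
  proof -
    have "\<beta> \<le> P * r" using that by (simp add: divide_le_eq)
    also have "\<dots> < (P + 1) * r" using that by (simp add: distrib_right)
    finally show ?thesis using Ppos by (simp add: c_def divide_less_eq mult.commute)
  qed
  obtain W where W: "\<forall>t\<in>{0..T}. \<bar>w t\<bar> \<le> W"
    using compact_imp_bounded[OF compact_continuous_image[OF contw]] by (auto simp: bounded_iff)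
  then have Wpos: "0 \<le> W" using T by force
  \<comment> \<open>The gap opens at most at speed \<open>W\<close>; the summand \<open>1\<close> makes the bound strict.\<close>
  define C where "C = h0 + W * T + 1"
  have hC: "c < h0" "h0 < C"
    using above_c[OF P0 h0] Wpos T by (auto simp: C_def intro!: add_nonneg_pos)
  obtain L where L: "0 < L" "\<And>w t z z'. norm (clamped_field \<alpha> \<beta> V c C w t z - clamped_field \<alpha> \<beta> V c C w t z') \<le> L * norm (z - z')"
    using clamped_field_lipschitz[of c C] c hC by (metis less_imp_le less_trans)
  obtain z where z0: "z 0 = (h0, v0 + \<beta> / h0)"
    and z: "\<And>t. t \<in> {0..T} \<Longrightarrow>
      (z has_vector_derivative clamped_field \<alpha> \<beta> V c C w t (z t)) (at t within {0..T})"
    using lipschitz_ode_solution[of T L "clamped_field \<alpha> \<beta> V c C w" "(h0, v0 + \<beta> / h0)"]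
      T L continuous_on_clamped_field[OF c contw] by metis
  define h v where "h t = fst (z t)" and "v t = snd (z t) - \<beta> / fst (z t)" for t
  have init: "h 0 = h0" "v 0 = v0"
    by (simp_all add: h_def v_def z0)
  have "continuous_on {0..T} z"
    by (rule continuous_on_vector_derivative) (rule z)
  then have conth: "continuous_on {0..T} h"
    unfolding h_def by (intro continuous_intros)
  have local: "gap_system \<alpha> \<beta> V \<tau> w h v"
    if "\<tau> \<le> T" "\<And>t. t \<in> {0..\<tau>} \<Longrightarrow> h t \<in> {c..C}" for \<tau>
    unfolding h_def v_def
    using that c
    by (intro clamped_field_imp_gap_system[where c = c and C = C] has_vector_derivative_within_subset[OF z])
       (auto simp: h_def)
  have strict: "c < h \<tau> \<and> h \<tau> < C"
    if tau: "0 \<le> \<tau>" "\<tau> \<le> T" and range: "\<And>t. t \<in> {0..\<tau>} \<Longrightarrow> h t \<in> {c..C}" for \<tau>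
  proof
    note sys = local[OF tau(2) range]
    have w': "0 \<le> w t" if "t \<in> {0..\<tau>}" for t
      using w that tau by auto
    have vel: "0 \<le> v t" and pot: "v t + \<beta> / h t \<le> v 0 + \<beta> / h 0 + \<alpha> * K * t"
      if "t \<in> {0..\<tau>}" for t
      using gap_system_velocity_nonneg[OF sys w' _ that] gap_system_potential_bound[OF sys w' _ that]
        v0 init by simp_all
    have "\<alpha> * K * \<tau> \<le> \<alpha> * K * T"
      using alpha K_nonneg tau by (intro mult_left_mono) auto
    then have "\<beta> / h \<tau> \<le> P"
      using vel[of \<tau>] pot[of \<tau>] tau init by (simp add: P_def)
    moreover have "0 < h \<tau>"
      using range[of \<tau>] tau c by auto
    ultimately show "c < h \<tau>" by (rule above_c)
    have "W * 0 - h 0 \<le> W * \<tau> - h \<tau>"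
    proof (rule deriv_nonneg_imp_le[where f = "\<lambda>t. W * t - h t" and f' = "\<lambda>t. W - (w t - v t)" and T = \<tau>])
      fix s assume s: "s \<in> {0..\<tau>}"
      have "(h has_real_derivative w s - v s) (at s within {0..\<tau>})"
        using sys s by (simp add: gap_system_def)
      then show "((\<lambda>t. W * t - h t) has_real_derivative W - (w s - v s)) (at s within {0..\<tau>})"
        by (auto intro!: derivative_eq_intros)
      show "0 \<le> W - (w s - v s)"
        using W[rule_format, of s] vel[OF s] s tau by simp
    qed (use tau in auto)
    moreover have "W * \<tau> \<le> W * T"
      using tau Wpos by (rule_tac mult_left_mono) auto
    ultimately show "h \<tau> < C"
      using init by (simp add: C_def)
  qed
  have inside: "h t \<in> {c..C}" if t: "t \<in> {0..T}" for t
  proof (rule ccontr)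
    assume out: "h t \<notin> {c..C}"
    define S where "S = {0..T} \<inter> h -` ({..c} \<union> {C..})"
    have "closed S"
      unfolding S_def by (intro continuous_closed_preimage conth closed_Un) auto
    moreover have "bounded S"
      unfolding S_def by (rule bounded_subset[OF bounded_closed_interval]) auto
    ultimately have "compact S"
      by (simp add: compact_eq_bounded_closed)
    moreover have "S \<noteq> {}" using out t by (auto simp: S_def)
    ultimately obtain \<tau> where tau: "\<tau> \<in> S" and first: "\<And>s. s \<in> S \<Longrightarrow> \<tau> \<le> s"
      using compact_attains_inf by metis
    have tau': "0 < \<tau>" "\<tau> \<le> T"
      using tau hC init by (auto simp: S_def less_le)
    have before: "h s \<in> {c..C}" if "s \<in> {0..<\<tau>}" for s
      using first[of s] that tau' by (force simp: S_def)
    have clos: "closure {0..<\<tau>} = {0..\<tau>}"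
      using tau' by simp
    have cont': "continuous_on (closure {0..<\<tau>}) h"
      unfolding clos using tau' by (intro continuous_on_subset[OF conth]) auto
    have "h s \<in> {c..C}" if "s \<in> {0..\<tau>}" for s
      using continuous_ge_on_closure[OF cont', of s c] continuous_le_on_closure[OF cont', of s C]
        that before unfolding clos by auto
    then have "c < h \<tau> \<and> h \<tau> < C"
      using strict tau' by simp
    then show False
      using tau by (auto simp: S_def)
  qed
  show thesis
    by (rule that[OF local[OF order_refl inside] init])
qed

text \<open>Both gaps are continuous and positive on a compact interval, so they stay in a common \<open>[b,B]\<close>
  with \<open>b > 0\<close>, where both solutions solve the same clamped Lipschitz system.\<close>

lemma gap_system_unique:
  assumes 1: "gap_system \<alpha> \<beta> V T w h v" and 2: "gap_system \<alpha> \<beta> V T w h' v'"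
    and init: "h 0 = h' 0" "v 0 = v' 0" and t: "t \<in> {0..T}"
  shows "h t = h' t \<and> v t = v' t"
proof -
  have bounds: "\<exists>c C. 0 < c \<and> (\<forall>t\<in>{0..T}. h t \<in> {c..C})" if "gap_system \<alpha> \<beta> V T w h v" for h v
  proof -
    have cont: "continuous_on {0..T} h"
      using that unfolding gap_system_def by (intro DERIV_continuous_on) auto
    have ne: "{0..T} \<noteq> {}" using t by auto
    obtain r where r: "r \<in> {0..T}" "\<forall>t\<in>{0..T}. h r \<le> h t"
      using continuous_attains_inf[OF compact_Icc ne cont] by blast
    obtain s where s: "\<forall>t\<in>{0..T}. h t \<le> h s"
      using continuous_attains_sup[OF compact_Icc ne cont] by blast
    have "0 < h r"
      using that r(1) by (simp add: gap_system_def)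
    then show ?thesis
      using r(2) s by (intro exI[of _ "h r"] exI[of _ "h s"]) simp
  qed
  obtain c C c' C' where c: "0 < c" "0 < c'"
    and range: "\<And>t. t \<in> {0..T} \<Longrightarrow> h t \<in> {c..C}" "\<And>t. t \<in> {0..T} \<Longrightarrow> h' t \<in> {c'..C'}"
    using bounds[OF 1] bounds[OF 2] by metis
  define b B where "b = min c c'" and "B = max C C'"
  have b: "0 < b" and range': "\<And>t. t \<in> {0..T} \<Longrightarrow> h t \<in> {b..B}" "\<And>t. t \<in> {0..T} \<Longrightarrow> h' t \<in> {b..B}"
    using c range by (simp_all add: b_def B_def min_le_iff_disj le_max_iff_disj)
  have "b \<le> B" using range'(1)[OF t] by simp
  then obtain L where L: "\<And>w t z z'. norm (clamped_field \<alpha> \<beta> V b B w t z - clamped_field \<alpha> \<beta> V b B w t z') \<le> L * norm (z - z')"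
    using clamped_field_lipschitz[OF b] by metis
  have "(h t, v t + \<beta> / h t) = (h' t, v' t + \<beta> / h' t)"
    by (rule lipschitz_ode_unique[where F = "clamped_field \<alpha> \<beta> V b B w" and L = L and T = T
          and y = "\<lambda>t. (h t, v t + \<beta> / h t)" and z = "\<lambda>t. (h' t, v' t + \<beta> / h' t)"])
       (use gap_system_imp_clamped_field[OF 1 range'(1)] gap_system_imp_clamped_field[OF 2 range'(2)]
          L init t in auto)
  then show ?thesis by auto
qed

definition follows :: "real \<Rightarrow> (real \<Rightarrow> real) \<Rightarrow> (real \<Rightarrow> real) \<Rightarrow> (real \<Rightarrow> real) \<Rightarrow> (real \<Rightarrow> real) \<Rightarrow> bool" where
  "follows T y w x v \<longleftrightarrow> (\<forall>t\<in>{0..T}.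
     (x has_real_derivative v t) (at t within {0..T}) \<and>
     (v has_real_derivative Acc \<alpha> \<beta> V l (x t) (y t) (v t) (w t)) (at t within {0..T}) \<and>
     0 < y t - x t - l)"

text \<open>Passing from positions to gaps loses nothing, since the trajectory \<open>y\<close> of the leader is given.\<close>

lemma follows_iff_gap_system:
  assumes y: "\<And>t. t \<in> {0..T} \<Longrightarrow> (y has_real_derivative w t) (at t within {0..T})"
  shows "follows T y w x v \<longleftrightarrow> gap_system \<alpha> \<beta> V T w (\<lambda>t. y t - x t - l) v"
proof -
  have "(x has_real_derivative v t) (at t within {0..T}) \<longleftrightarrow>
      ((\<lambda>t. y t - x t - l) has_real_derivative w t - v t) (at t within {0..T})"
    (is "?L \<longleftrightarrow> ?R") if t: "t \<in> {0..T}" for t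
  proof
    assume ?L
    then show ?R by (auto intro!: derivative_eq_intros y[OF t])
  next
    assume ?R
    from DERIV_diff[OF DERIV_diff[OF y[OF t] this] DERIV_const[of l]]
    show ?L by simp
  qed
  then show ?thesis
    by (auto simp: follows_def gap_system_def Acc_def)
qed

lemma follows_exists:
  assumes T: "0 \<le> T" and contw: "continuous_on {0..T} w"
    and y: "\<And>t. t \<in> {0..T} \<Longrightarrow> (y has_real_derivative w t) (at t within {0..T})"
    and w: "\<And>t. t \<in> {0..T} \<Longrightarrow> 0 \<le> w t" and v0: "0 \<le> v0" and gap: "0 < y 0 - x0 - l"
  obtains x v where "follows T y w x v" "x 0 = x0" "v 0 = v0"
proof -
  obtain h v where "gap_system \<alpha> \<beta> V T w h v" "h 0 = y 0 - x0 - l" "v 0 = v0"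
    using gap_system_exists[OF T contw w v0 gap] by metis
  then show thesis
    using that[of "\<lambda>t. y t - h t - l" v]
      follows_iff_gap_system[where x = "\<lambda>t. y t - h t - l" and v = v and w = w and y = y and T = T, OF y]
    by simp
qed

lemma continuous_on_Acc:
  assumes cont: "continuous_on S x" "continuous_on S y" "continuous_on S v" "continuous_on S w"
    and gap: "\<And>t. t \<in> S \<Longrightarrow> 0 < y t - x t - l"
  shows "continuous_on S (\<lambda>t. Acc \<alpha> \<beta> V l (x t) (y t) (v t) (w t))"
proof -
  have "continuous_on S (\<lambda>t. V (y t - x t - l))"
    by (rule continuous_on_compose2[OF C1_differentiable_imp_continuous_on[OF V_C1]])
       (use gap in \<open>auto intro!: continuous_intros cont\<close>)
  then show ?thesis
    unfolding Acc_def using gap by (intro continuous_intros cont) (auto dest: less_imp_neq)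
qed

end

section \<open>The whole platoon\<close>

text \<open>The leader trajectory counts as vehicle \<open>0\<close>, which is what the function updates at index \<open>0\<close>
  express.\<close>

locale platoon = bando_ftl +
  fixes T :: real and n :: nat and Ia :: "nat set"
    and xl vl :: "real \<Rightarrow> real" and xo vo :: "nat \<Rightarrow> real"
  assumes T: "0 < T" and Ia: "Ia \<subseteq> {1..n}"
    and leader: "primitive_on T xl vl" and contvl: "continuous_on {0..T} vl"
    and vl_nonneg: "\<And>t. t \<in> {0..T} \<Longrightarrow> 0 \<le> vl t"
    and vo_nonneg: "\<And>i. i \<in> {1..n} \<Longrightarrow> 0 \<le> vo i"
    and initial_gap: "\<And>i. i \<in> {1..n} \<Longrightarrow> 0 < (xo(0 := xl 0)) (i - 1) - xo i - l"
begin

text \<open>The equations of vehicle \<open>i\<close> behind the trajectory \<open>y\<close> with velocity \<open>w\<close>. A control is merely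
  essentially bounded, so the equation for the velocity of an autonomous vehicle is stated in
  integrated form; all other equations hold pointwise.\<close>

definition vehicle ::
  "(nat \<Rightarrow> real \<Rightarrow> real) \<Rightarrow> nat \<Rightarrow> (real \<Rightarrow> real) \<Rightarrow> (real \<Rightarrow> real) \<Rightarrow> (real \<Rightarrow> real) \<Rightarrow> (real \<Rightarrow> real) \<Rightarrow> bool" where
  "vehicle u i y w x v \<longleftrightarrow> x 0 = xo i \<and> v 0 = vo i \<and> continuous_on {0..T} v \<and> primitive_on T x v \<and>
     (if i \<in> Ia then primitive_on T v (u i) else follows T y w x v)"

definition classical_solution ::
  "(nat \<Rightarrow> real \<Rightarrow> real) \<Rightarrow> (nat \<Rightarrow> real \<Rightarrow> real) \<Rightarrow> (nat \<Rightarrow> real \<Rightarrow> real) \<Rightarrow> bool" where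
  "classical_solution u x v \<longleftrightarrow>
     (\<forall>i\<in>{1..n}. vehicle u i ((x(0 := xl)) (i - 1)) ((v(0 := vl)) (i - 1)) (x i) (v i))"

text \<open>What well-posedness needs of a control: every autonomous vehicle drives forward, so that its
  successor follows a leader with nonnegative velocity.\<close>

definition forward_control :: "(nat \<Rightarrow> real \<Rightarrow> real) \<Rightarrow> bool" where
  "forward_control u \<longleftrightarrow> (\<forall>i\<in>Ia. Linfty {0<..<T} (u i) \<and>
     (\<forall>t\<in>{0..T}. 0 \<le> vo i + integral {0..t} (u i)))"

lemma continuous_on_leader:
  assumes "\<And>i. i \<in> {1..n} \<Longrightarrow> continuous_on {0..T} (x i)" "continuous_on {0..T} x0" "i \<in> {1..n}"
  shows "continuous_on {0..T} ((x(0 := x0)) (i - 1))"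
proof (cases "i = 1")
  case False
  then have "i - 1 \<in> {1..n}" "i - 1 \<noteq> 0" using assms(3) by auto
  then show ?thesis using assms(1) by simp
qed (simp add: assms(2))

text \<open>All velocities and, where the gap is positive, all accelerations of human drivers are continuous
  and therefore essentially bounded, so each equation is covered by
  \<open>weak_derivative_iff_primitive\<close>. Conversely the Sobolev regularity comes for free from
  the equations.\<close>

lemma is_solution_iff_classical:
  assumes u: "\<And>i. i \<in> Ia \<Longrightarrow> Linfty {0<..<T} (u i)"
  shows "is_solution T l \<alpha> \<beta> V {1..n} Ia xl vl xo vo u x v \<longleftrightarrow> classical_solution u x v"
proof
  assume sol: "is_solution T l \<alpha> \<beta> V {1..n} Ia xl vl xo vo u x v"
  have contx: "continuous_on {0..T} (x i)" and contv: "continuous_on {0..T} (v i)"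
    if "i \<in> {1..n}" for i
    using sol that unfolding is_solution_def by blast+
  show "classical_solution u x v"
    unfolding classical_solution_def
  proof
    fix i assume i: "i \<in> {1..n}"
    let ?y = "(x(0 := xl)) (i - 1)" and ?w = "(v(0 := vl)) (i - 1)"
    let ?a = "\<lambda>t. Acc \<alpha> \<beta> V l (x i t) (?y t) (v i t) (?w t)"
    have init: "x i 0 = xo i" "v i 0 = vo i"
      using sol i unfolding is_solution_def by blast+
    have prim_x: "primitive_on T (x i) (v i)"
      using sol i unfolding is_solution_def
      by (subst weak_derivative_iff_primitive[OF T contx[OF i] continuous_imp_Linfty[OF contv[OF i]], symmetric]) blast
    have "if i \<in> Ia then primitive_on T (v i) (u i) else follows T ?y ?w (x i) (v i)"
    proof (cases "i \<in> Ia")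
      case True
      then show ?thesis
        using sol weak_derivative_iff_primitive[OF T contv[OF i] u[OF True]]
        unfolding is_solution_def by simp
    next
      case False
      have gap: "0 < ?y t - x i t - l" if "t \<in> {0..T}" for t
        using sol i False that unfolding is_solution_def by blast
      have conta: "continuous_on {0..T} ?a"
        by (intro continuous_on_Acc contx contv i continuous_on_leader contvl gap
            primitive_on_continuous[OF leader])
      have "\<exists>v'. has_weak_derivative T (v i) v' \<and> (AE t in lebesgue_on {0..T}. v' t = ?a t)"
        using sol i False unfolding is_solution_def by blast
      then have "primitive_on T (v i) ?a"
        unfolding weak_derivative_iff_primitive[OF T contv[OF i] continuous_imp_Linfty[OF conta]] .
      then have "follows T ?y ?w (x i) (v i)"
        using prim_x gap unfolding follows_def primitive_on_continuous_iff[OF conta]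
          primitive_on_continuous_iff[OF contv[OF i]] by blast
      then show ?thesis
        using False by (simp only: if_False)
    qed
    then show "vehicle u i ?y ?w (x i) (v i)"
      using init contv[OF i] prim_x unfolding vehicle_def by blast
  qed
next
  assume sol: "classical_solution u x v"
  have veh: "vehicle u i ((x(0 := xl)) (i - 1)) ((v(0 := vl)) (i - 1)) (x i) (v i)"
    if "i \<in> {1..n}" for i
    using sol that by (simp add: classical_solution_def)
  have contv: "continuous_on {0..T} (v i)" and prim_x: "primitive_on T (x i) (v i)"
    and init: "x i 0 = xo i" "v i 0 = vo i" if "i \<in> {1..n}" for i
    using veh[OF that] by (simp_all add: vehicle_def)
  have contx: "continuous_on {0..T} (x i)" if "i \<in> {1..n}" for i
    using prim_x[OF that] by (rule primitive_on_continuous)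
  let ?a = "\<lambda>i t. Acc \<alpha> \<beta> V l (x i t) ((x(0 := xl)) (i - 1) t) (v i t) ((v(0 := vl)) (i - 1) t)"
  have human: "Linfty {0<..<T} (?a i)" "primitive_on T (v i) (?a i)"
    and gap: "\<And>t. t \<in> {0..T} \<Longrightarrow> 0 < (x(0 := xl)) (i - 1) t - x i t - l"
    if i: "i \<in> {1..n} - Ia" for i
  proof -
    have i': "i \<in> {1..n}" using i by simp
    have fol: "follows T ((x(0 := xl)) (i - 1)) ((v(0 := vl)) (i - 1)) (x i) (v i)"
      using veh[OF i'] i by (simp add: vehicle_def)
    show gap: "0 < (x(0 := xl)) (i - 1) t - x i t - l" if "t \<in> {0..T}" for t
      using fol that unfolding follows_def by blast
    have conta: "continuous_on {0..T} (?a i)"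
      by (intro continuous_on_Acc contx contv i' continuous_on_leader contvl gap
          primitive_on_continuous[OF leader])
    then show "Linfty {0<..<T} (?a i)" by (rule continuous_imp_Linfty)
    show "primitive_on T (v i) (?a i)"
      unfolding primitive_on_continuous_iff[OF conta] using fol unfolding follows_def by blast
  qed
  have av: "primitive_on T (v i) (u i)" if "i \<in> Ia" for i
    using veh[of i] Ia that by (auto simp: vehicle_def)
  have sob1: "sobolev_inf 1 T (v i)" if "i \<in> {1..n}" for i
    using sobolev_inf_1[OF T] human[of i] av[of i] u[of i] that by blast
  show "is_solution T l \<alpha> \<beta> V {1..n} Ia xl vl xo vo u x v"
    unfolding is_solution_def
  proof (intro conjI ballI)
    fix i assume i: "i \<in> {1..n}"
    show "sobolev_inf 2 T (x i)"
      by (rule sobolev_inf_2[OF T prim_x[OF i] sob1[OF i]])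
    show "\<exists>x'. has_weak_derivative T (x i) x' \<and> (AE t in lebesgue_on {0..T}. x' t = v i t)"
      by (simp add: weak_derivative_iff_primitive[OF T contx[OF i] continuous_imp_Linfty[OF contv[OF i]]] prim_x[OF i])
  next
    fix i assume i: "i \<in> {1..n} - Ia"
    show "\<exists>v'. has_weak_derivative T (v i) v' \<and> (AE t in lebesgue_on {0..T}. v' t = ?a i t)"
      using i human(2)[OF i]
      by (subst weak_derivative_iff_primitive[OF T contv human(1)[OF i]]) auto
  next
    fix i assume i: "i \<in> Ia"
    then have "i \<in> {1..n}" using Ia by blast
    show "\<exists>v'. has_weak_derivative T (v i) v' \<and> (AE t in lebesgue_on {0..T}. v' t = u i t)"
      using av[OF i] by (simp add: weak_derivative_iff_primitive[OF T contv[OF \<open>i \<in> {1..n}\<close>] u[OF i]])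
  qed (simp_all only: contx contv sob1 init gap)
qed

lemma vehicle_velocity_nonneg:
  assumes veh: "vehicle u i y w x v" and i: "i \<in> {1..n}" and u: "forward_control u"
    and y: "\<And>t. t \<in> {0..T} \<Longrightarrow> (y has_real_derivative w t) (at t within {0..T})"
    and w: "\<And>t. t \<in> {0..T} \<Longrightarrow> 0 \<le> w t" and t: "t \<in> {0..T}"
  shows "0 \<le> v t"
proof (cases "i \<in> Ia")
  case True
  then have "primitive_on T v (u i)" "v 0 = vo i"
    using veh by (auto simp: vehicle_def)
  then have "v t = vo i + integral {0..t} (u i)"
    using primitive_on_eq t by metis
  then show ?thesis
    using u True t by (simp add: forward_control_def)
next
  case False
  then have sys: "gap_system \<alpha> \<beta> V T w (\<lambda>t. y t - x t - l) v"
    using veh follows_iff_gap_system[where w = w and y = y and T = T, OF y] by (simp add: vehicle_def)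
  have v0: "0 \<le> v 0"
    using veh vo_nonneg[OF i] by (simp add: vehicle_def)
  show ?thesis
    by (rule gap_system_velocity_nonneg[OF sys w v0 t])
qed

lemma vehicle_exists:
  assumes i: "i \<in> {1..n}" and u: "forward_control u"
    and contw: "continuous_on {0..T} w" and y: "primitive_on T y w"
    and w: "\<And>t. t \<in> {0..T} \<Longrightarrow> 0 \<le> w t" and gap: "0 < y 0 - xo i - l"
  shows "\<exists>x v. vehicle u i y w x v"
proof (cases "i \<in> Ia")
  case True
  define v where "v t = vo i + integral {0..t} (u i)" for t
  define x where "x t = xo i + integral {0..t} v" for t
  have v: "primitive_on T v (u i)"
    using u True unfolding v_def forward_control_def by (intro primitive_on_integral) auto
  then have contv: "continuous_on {0..T} v"
    by (rule primitive_on_continuous)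
  have "primitive_on T x v"
    unfolding x_def by (intro primitive_on_integral continuous_imp_Linfty contv)
  then have "vehicle u i y w x v"
    using True v contv by (simp add: vehicle_def x_def v_def)
  then show ?thesis by blast
next
  case False
  have dy: "\<And>t. t \<in> {0..T} \<Longrightarrow> (y has_real_derivative w t) (at t within {0..T})"
    using y primitive_on_continuous_iff[OF contw] by blast
  obtain x v where xv: "follows T y w x v" "x 0 = xo i" "v 0 = vo i"
    using follows_exists[OF less_imp_le[OF T] contw dy w vo_nonneg[OF i] gap] by blast
  have contv: "continuous_on {0..T} v"
    by (rule DERIV_continuous_on) (use xv(1) in \<open>auto simp: follows_def\<close>)
  have "vehicle u i y w x v"
    using xv contv False by (simp add: vehicle_def primitive_on_continuous_iff follows_def)
  then show ?thesis by blast
qed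

lemma vehicle_unique:
  assumes veh: "vehicle u i y w x v" "vehicle u i y' w' x' v'"
    and contw: "continuous_on {0..T} w" and y: "primitive_on T y w"
    and eq: "\<And>t. t \<in> {0..T} \<Longrightarrow> y' t = y t \<and> w' t = w t" and t: "t \<in> {0..T}"
  shows "x' t = x t \<and> v' t = v t"
proof (cases "i \<in> Ia")
  case True
  have v: "v' t = v t" if "t \<in> {0..T}" for t
    using primitive_on_unique[of T v' "u i" v t] veh True that by (simp add: vehicle_def)
  have "primitive_on T x' v"
    using veh(2) primitive_on_cong[of T x' x' v' v] v by (simp add: vehicle_def)
  then have "x' t = x t"
    using primitive_on_unique[of T x' v x t] veh t by (simp add: vehicle_def)
  then show ?thesis using v t by simp
next
  case False
  have dy: "\<And>t. t \<in> {0..T} \<Longrightarrow> (y has_real_derivative w t) (at t within {0..T})"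
    using y primitive_on_continuous_iff[OF contw] by blast
  have fol: "follows T y w x v" "follows T y' w' x' v'"
    using veh False by (simp_all add: vehicle_def)
  have fol': "follows T y w x' v'"
    using fol(2) eq unfolding follows_def by simp
  note iff = follows_iff_gap_system[where w = w and y = y and T = T, OF dy]
  have "gap_system \<alpha> \<beta> V T w (\<lambda>t. y t - x' t - l) v'" "gap_system \<alpha> \<beta> V T w (\<lambda>t. y t - x t - l) v"
    using fol(1) fol' iff by simp_all
  moreover have "y 0 - x' 0 - l = y 0 - x 0 - l" "v' 0 = v 0"
    using veh by (simp_all add: vehicle_def)
  ultimately show ?thesis
    using gap_system_unique[OF _ _ _ _ t] by fastforce
qed

text \<open>Every vehicle is a legitimate leader for the next one.\<close>

lemma classical_solution_leader:
  assumes sol: "classical_solution u x v" and u: "forward_control u" and "i \<le> n"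
  shows "continuous_on {0..T} ((v(0 := vl)) i)" "primitive_on T ((x(0 := xl)) i) ((v(0 := vl)) i)"
    and "\<And>t. t \<in> {0..T} \<Longrightarrow> 0 \<le> (v(0 := vl)) i t"
  using \<open>i \<le> n\<close>
proof (induction i)
  case 0
  {
    case 1 then show ?case using contvl by simp
  next
    case 2 then show ?case using leader by simp
  next
    case 3 then show ?case using vl_nonneg by simp
  }
next
  case (Suc i)
  have veh: "vehicle u (Suc i) ((x(0 := xl)) i) ((v(0 := vl)) i) (x (Suc i)) (v (Suc i))" if "Suc i \<le> n"
    using sol that unfolding classical_solution_def by (auto dest: bspec[of _ _ "Suc i"])
  {
    case 1 then show ?case using veh by (simp add: vehicle_def)
  next
    case 2 then show ?case using veh by (simp add: vehicle_def)
  next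
    case 3
    have "\<And>t. t \<in> {0..T} \<Longrightarrow> ((x(0 := xl)) i has_real_derivative (v(0 := vl)) i t) (at t within {0..T})"
      using Suc.IH(1,2) 3 primitive_on_continuous_iff by auto
    from vehicle_velocity_nonneg[OF veh _ u this Suc.IH(3)] show ?case using 3 by simp
  }
qed

text \<open>The vehicles are constructed one after the other, starting from the given leader. The invariant
  \<open>P\<close> collects what \<open>vehicle_exists\<close> demands of a leader; it is void beyond the last vehicle.\<close>

lemma classical_solution_exists:
  assumes u: "forward_control u"
  shows "\<exists>x v. classical_solution u x v"
proof -
  define P where "P k p \<longleftrightarrow> (k = 0 \<longrightarrow> p = (xl, vl)) \<and> (k \<le> n \<longrightarrow> continuous_on {0..T} (snd p) \<and>
     primitive_on T (fst p) (snd p) \<and> (\<forall>t\<in>{0..T}. 0 \<le> snd p t) \<and> fst p 0 = (xo(0 := xl 0)) k)"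
    for k and p :: "(real \<Rightarrow> real) \<times> (real \<Rightarrow> real)"
  define Q where "Q k p q \<longleftrightarrow> (k < n \<longrightarrow> vehicle u (Suc k) (fst p) (snd p) (fst q) (snd q))"
    for k and p q :: "(real \<Rightarrow> real) \<times> (real \<Rightarrow> real)"
  have "\<exists>f. \<forall>k. P k (f k) \<and> Q k (f k) (f (Suc k))"
  proof (rule dependent_nat_choice)
    show "\<exists>p. P 0 p"
      using leader contvl vl_nonneg by (auto simp: P_def)
  next
    fix p k assume p: "P k p"
    show "\<exists>q. P (Suc k) q \<and> Q k p q"
    proof (cases "k < n")
      case False
      then show ?thesis by (simp add: P_def Q_def)
    next
      case True
      then have i: "Suc k \<in> {1..n}" by simp
      have p': "continuous_on {0..T} (snd p)" "primitive_on T (fst p) (snd p)"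
        "\<And>t. t \<in> {0..T} \<Longrightarrow> 0 \<le> snd p t" "fst p 0 = (xo(0 := xl 0)) k"
        using p True by (simp_all add: P_def)
      have gap: "0 < fst p 0 - xo (Suc k) - l"
        using initial_gap[OF i] p'(4) by simp
      obtain x v where veh: "vehicle u (Suc k) (fst p) (snd p) x v"
        using vehicle_exists[OF i u p'(1-3) gap] by blast
      have "\<And>t. t \<in> {0..T} \<Longrightarrow> (fst p has_real_derivative snd p t) (at t within {0..T})"
        using p'(1,2) primitive_on_continuous_iff by blast
      from vehicle_velocity_nonneg[OF veh i u this p'(3)]
      have "\<forall>t\<in>{0..T}. 0 \<le> v t" by blast
      then have "P (Suc k) (x, v)"
        using veh by (simp add: P_def vehicle_def)
      moreover have "Q k p (x, v)"
        using veh by (simp add: Q_def)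
      ultimately show ?thesis by blast
    qed
  qed
  then obtain f where "\<forall>k. P k (f k) \<and> Q k (f k) (f (Suc k))" ..
  then have f: "P k (f k)" "Q k (f k) (f (Suc k))" for k
    by auto
  have f0: "f 0 = (xl, vl)" using f(1)[of 0] by (simp add: P_def)
  define x v where "x i = fst (f i)" and "v i = snd (f i)" for i
  have upd: "x(0 := xl) = x" "v(0 := vl) = v"
    by (auto simp: x_def v_def f0)
  have "classical_solution u x v"
    unfolding classical_solution_def upd
  proof
    fix i assume i: "i \<in> {1..n}"
    then show "vehicle u i (x (i - 1)) (v (i - 1)) (x i) (v i)"
      using f(2)[of "i - 1"] by (cases i) (simp_all add: Q_def x_def v_def)
  qed
  then show ?thesis by blast
qed

text \<open>Induction along the lane: if both solutions agree on the vehicle in front, they agree on the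
  vehicle itself by \<open>vehicle_unique\<close>.\<close>

lemma classical_solution_unique:
  assumes sol: "classical_solution u x v" "classical_solution u x' v'" and u: "forward_control u"
    and "i \<le> n" and t: "t \<in> {0..T}"
  shows "(x'(0 := xl)) i t = (x(0 := xl)) i t \<and> (v'(0 := vl)) i t = (v(0 := vl)) i t"
  using \<open>i \<le> n\<close> t
proof (induction i arbitrary: t)
  case (Suc i)
  then have "Suc i \<in> {1..n}" "i \<le> n" by auto
  have veh: "vehicle u (Suc i) ((x(0 := xl)) i) ((v(0 := vl)) i) (x (Suc i)) (v (Suc i))"
    "vehicle u (Suc i) ((x'(0 := xl)) i) ((v'(0 := vl)) i) (x' (Suc i)) (v' (Suc i))"
    using bspec[OF sol(1)[unfolded classical_solution_def] \<open>Suc i \<in> {1..n}\<close>]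
      bspec[OF sol(2)[unfolded classical_solution_def] \<open>Suc i \<in> {1..n}\<close>] by simp_all
  from vehicle_unique[OF veh classical_solution_leader(1,2)[OF sol(1) u \<open>i \<le> n\<close>] Suc.IH[OF \<open>i \<le> n\<close>] Suc.prems(2)]
  show ?case by simp
qed simp

lemma ex_unique_solution_forward_control:
  assumes u: "forward_control u"
  shows "ex_unique_solution T l \<alpha> \<beta> V {1..n} Ia xl vl xo vo u"
proof -
  have iff: "is_solution T l \<alpha> \<beta> V {1..n} Ia xl vl xo vo u x v \<longleftrightarrow> classical_solution u x v" for x v
    using u by (intro is_solution_iff_classical) (simp add: forward_control_def)
  obtain x v where xv: "classical_solution u x v"
    using classical_solution_exists[OF u] by blast
  have "y i t = x i t \<and> w i t = v i t"
    if "classical_solution u y w" "i \<in> {1..n}" "t \<in> {0..T}" for y w i t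
    using classical_solution_unique[OF xv that(1) u _ that(3), of i] that(2) by simp
  then show ?thesis
    unfolding ex_unique_solution_def iff using xv by blast
qed

end

section \<open>Emergency braking\<close>

text \<open>Starting from velocity \<open>v0\<close>, constant deceleration \<open>b\<close> leads to standstill at time \<open>v0 / b\<close>.\<close>

definition brake :: "real \<Rightarrow> real \<Rightarrow> real \<Rightarrow> real" where
  "brake b v0 t = (if b * t < v0 then - b else 0)"

lemma primitive_on_brake:
  assumes b: "0 < b" and v0: "0 \<le> v0"
  shows "primitive_on T (\<lambda>t. max 0 (v0 - b * t)) (brake b v0)"
  unfolding primitive_on_def
proof
  fix t assume t: "t \<in> {0..T}"
  show "(brake b v0 has_integral max 0 (v0 - b * t) - max 0 (v0 - b * 0)) {0..t}"
  proof (rule fundamental_theorem_of_calculus_interior_strong[where S = "{v0 / b}"])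
    show "continuous_on {0..t} (\<lambda>t. max 0 (v0 - b * t))"
      by (intro continuous_intros)
  next
    fix s assume s: "s \<in> {0<..<t} - {v0 / b}"
    have "((\<lambda>t. max 0 (v0 - b * t)) has_real_derivative brake b v0 s) (at s)"
    proof (cases "s < v0 / b")
      case True
      have "((\<lambda>t. v0 - b * t) has_real_derivative - b) (at s)"
        by (auto intro!: derivative_eq_intros)
      then have "((\<lambda>t. max 0 (v0 - b * t)) has_real_derivative - b) (at s)"
        by (rule has_field_derivative_transform_within_open[where S = "{..<v0 / b}"])
           (use True b in \<open>auto simp: field_simps max_def\<close>)
      then show ?thesis
        using True b by (simp add: brake_def field_simps)
    next
      case False
      have "((\<lambda>t. 0) has_real_derivative 0) (at s)" by simp
      then have "((\<lambda>t. max 0 (v0 - b * t)) has_real_derivative 0) (at s)"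
        by (rule has_field_derivative_transform_within_open[where S = "{v0 / b<..}"])
           (use False s b in \<open>auto simp: field_simps max_def\<close>)
      then show ?thesis
        using False b by (simp add: brake_def field_simps)
    qed
    then show "((\<lambda>t. max 0 (v0 - b * t)) has_vector_derivative brake b v0 s) (at s)"
      by (simp add: has_real_derivative_iff_has_vector_derivative)
  qed (use t in auto)
qed

lemma Linfty_brake: "Linfty {0<..<T} (brake b v0)"
proof -
  have "brake b v0 \<in> borel_measurable lborel"
    unfolding brake_def by measurable
  then have "brake b v0 \<in> borel_measurable (lebesgue_on {0<..<T})"
    by (intro measurable_restrict_space1 measurable_completion)
  moreover have "negligible {t \<in> {0<..<T}. \<not> \<bar>brake b v0 t\<bar> \<le> \<bar>b\<bar>}"
    by (rule negligible_subset[OF negligible_empty]) (auto simp: brake_def)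
  ultimately show ?thesis
    by (auto simp: Linfty_def AE_lebesgue_on_iff_negligible intro!: exI[of _ "\<bar>b\<bar>"])
qed

text \<open>The function \<open>x + (v\<^sub>0/b) v\<close> is nonincreasing: while braking its derivative is \<open>v - v\<^sub>0 \<le> 0\<close>, and
  afterwards it is \<open>0\<close>. The resulting bound is twice the true stopping distance.\<close>

lemma braking_distance:
  assumes b: "0 < b" and v0: "0 \<le> v 0"
    and v: "primitive_on T v (brake b (v 0))" and x: "primitive_on T x v" and t: "t \<in> {0..T}"
  shows "x t \<le> x 0 + (v 0)\<^sup>2 / b"
proof -
  have v_eq: "v s = max 0 (v 0 - b * s)" if "s \<in> {0..T}" for s
    using primitive_on_unique[OF v primitive_on_brake[OF b v0] _ that] v0 by simp
  define f where "f s = v s + v 0 / b * brake b (v 0) s" for s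
  have "(f has_integral (x t - x 0) + v 0 / b * (v t - v 0)) {0..t}"
    using x v t unfolding f_def primitive_on_def
    by (intro has_integral_add has_integral_mult_right) auto
  moreover have "f s \<le> 0" if "s \<in> {0..t}" for s
    using v_eq[of s] that t b by (auto simp: f_def brake_def)
  ultimately have "(x t - x 0) + v 0 / b * (v t - v 0) \<le> 0"
    using has_integral_nonneg[OF has_integral_neg, of f _ "{0..t}"] by force
  moreover have "0 \<le> v 0 / b * v t"
    using v_eq[OF t] v0 b by simp
  ultimately show ?thesis
    by (simp add: right_diff_distrib power2_eq_square)
qed

context platoon
begin

definition braking_control :: "real \<Rightarrow> nat \<Rightarrow> real \<Rightarrow> real" where
  "braking_control b i = (if i \<in> Ia then brake b (vo i) else (\<lambda>_. 0))"

lemma control_set_imp_forward_control: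
  assumes "u \<in> control_set T {1..n} Ia vo a_min a_max"
  shows "forward_control u"
  unfolding forward_control_def
proof (intro ballI conjI)
  fix i assume i: "i \<in> Ia"
  then show Linf: "Linfty {0<..<T} (u i)"
    using assms Ia by (auto simp: control_set_def)
  fix t assume t: "t \<in> {0..T}"
  have "0 \<le> vo i + (LINT s|lebesgue_on {0..t}. u i s)"
    using assms i t by (simp add: control_set_def)
  then show "0 \<le> vo i + integral {0..t} (u i)"
    by (simp add: LINT_eq_integral[OF Linf t])
qed

lemma braking_control_in_control_set:
  assumes b: "0 < b" and "0 < a_max"
  shows "braking_control b \<in> control_set T {1..n} Ia vo (- b) a_max"
proof -
  have Linf: "Linfty {0<..<T} (braking_control b i)" for i
    by (simp add: braking_control_def Linfty_brake continuous_imp_Linfty)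
  have "0 \<le> vo i + (LINT s|lebesgue_on {0..t}. braking_control b i s)"
    if i: "i \<in> Ia" and t: "t \<in> {0..T}" for i t
  proof -
    have "0 \<le> vo i" using i Ia vo_nonneg by blast
    from primitive_on_eq[OF primitive_on_brake[OF b this] t]
    have "vo i + integral {0..t} (brake b (vo i)) = max 0 (vo i - b * t)"
      using \<open>0 \<le> vo i\<close> by simp
    then show ?thesis
      using i by (simp add: LINT_eq_integral[OF Linf t]) (simp add: braking_control_def)
  qed
  moreover have "- b \<le> braking_control b i t \<and> braking_control b i t \<le> a_max" for i t
    using assms by (simp add: braking_control_def brake_def)
  moreover have "braking_control b i t = 0" if "i \<notin> Ia" for i t
    using that by (simp add: braking_control_def)
  ultimately show ?thesis
    using Linf by (simp add: control_set_def)
qed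

text \<open>The vehicle in front has nonnegative velocity in every solution, so the gap shrinks by at most
  the distance of \<open>braking_distance\<close>.\<close>

lemma braking_control_keeps_distance:
  assumes b: "0 < b" and "0 < a_max"
    and dist: "\<And>i. i \<in> Ia \<Longrightarrow> (vo i)\<^sup>2 / b \<le> (xo(0 := xl 0)) (i - 1) - xo i - l - d"
  shows "braking_control b \<in> admissible_controls T l \<alpha> \<beta> V {1..n} Ia xl vl xo vo d (- b) a_max"
proof -
  note ctrl = braking_control_in_control_set[OF assms(1,2)]
  note fwd = control_set_imp_forward_control[OF ctrl]
  have "d \<le> (x(0 := xl)) (i - 1) t - x i t - l"
    if sol: "is_solution T l \<alpha> \<beta> V {1..n} Ia xl vl xo vo (braking_control b) x v"
      and i: "i \<in> Ia" and t: "t \<in> {0..T}" for x v i t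
  proof -
    have cl: "classical_solution (braking_control b) x v"
      using sol fwd is_solution_iff_classical unfolding forward_control_def by blast
    have i': "i \<in> {1..n}" "i - 1 \<le> n" using i Ia by force+
    have init: "x j 0 = xo j" if "j \<in> {1..n}" for j
      using cl that by (simp add: classical_solution_def vehicle_def)
    have "vehicle (braking_control b) i ((x(0 := xl)) (i - 1)) ((v(0 := vl)) (i - 1)) (x i) (v i)"
      using cl i' unfolding classical_solution_def by blast
    then have veh: "v i 0 = vo i" "primitive_on T (v i) (brake b (v i 0))" "primitive_on T (x i) (v i)"
      using i by (simp_all add: vehicle_def braking_control_def)
    have "x i t \<le> xo i + (vo i)\<^sup>2 / b"
      using braking_distance[OF b _ veh(2,3) t] veh(1) init[OF i'(1)] vo_nonneg[OF i'(1)] by simp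
    moreover have "(x(0 := xl)) (i - 1) 0 \<le> (x(0 := xl)) (i - 1) t"
      using primitive_on_mono classical_solution_leader(2,3)[OF cl fwd i'(2)] t by blast
    moreover have "(x(0 := xl)) (i - 1) 0 = (xo(0 := xl 0)) (i - 1)"
      using init[of "i - 1"] i' by (cases "i = 1") auto
    ultimately show ?thesis
      using dist[OF i] by linarith
  qed
  then show ?thesis
    using ctrl by (auto simp only: admissible_controls_def mem_Collect_eq)
qed

end

section \<open>Admissible controls and well-posedness\<close>

theorem corollary3p4:
  fixes T l \<alpha> \<beta> d0 d_safe a_max :: real
    and V xl vl :: "real \<Rightarrow> real"
    and N M :: nat and I Ia :: "nat set"
    and xo vo :: "nat \<Rightarrow> real"
  assumes "T > 0" "l > 0" "\<alpha> > 0" "\<beta> > 0"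
    and "V C1_differentiable_on {0<..}" "\<And>s. s > 0 \<Longrightarrow> V s \<ge> 0" "Linfty {0..} V"
    and "\<And>s. s > 0 \<Longrightarrow> deriv V s \<ge> 0"
    and "N \<ge> 1" "M \<ge> 1" and "I = {1..N + M}" and "Ia \<subseteq> I" "card Ia = M"
    and "sobolev_inf 2 T xl" "continuous_on {0..T} xl"
    and "has_weak_derivative T xl vl" "continuous_on {0..T} vl" "\<And>t. t \<in> {0..T} \<Longrightarrow> vl t \<ge> 0"
    and "\<And>i. i \<in> I \<Longrightarrow> vo i \<ge> 0"
    and "d0 > 0" "xl 0 - xo 1 - l > d0"
    and "\<And>i. i \<in> {1..N + M - 1} \<Longrightarrow> xo i - xo (i + 1) - l > d0"
    and "0 < d_safe" "d_safe \<le> d0"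
    and "a_max > 0"
  shows "\<exists>a_bar<0. \<forall>a_min\<le>a_bar.
           admissible_controls T l \<alpha> \<beta> V I Ia xl vl xo vo d_safe a_min a_max \<noteq> {} \<and>
           (\<forall>u \<in> admissible_controls T l \<alpha> \<beta> V I Ia xl vl xo vo d_safe a_min a_max.
              ex_unique_solution T l \<alpha> \<beta> V I Ia xl vl xo vo u)"
proof -
  have V_cont: "continuous_on {0<..} V"
    using assms(5) by (rule C1_differentiable_imp_continuous_on)
  obtain K where K: "\<And>s. 0 < s \<Longrightarrow> \<bar>V s\<bar> \<le> K"
    using AE_bounded_continuous_imp_bounded[OF assms(7) V_cont] by blast
  have leader: "primitive_on T xl vl"
    using weak_derivative_iff_primitive[OF assms(1,15) continuous_imp_Linfty[OF assms(17)]] assms(16)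
    by auto
  define g where "g i = (xo(0 := xl 0)) (i - 1) - xo i - l" for i
  have gap: "d0 < g i" if "i \<in> {1..N + M}" for i
  proof (cases "i = 1")
    case True
    then show ?thesis using assms(21) by (simp add: g_def)
  next
    case False
    then have "i - 1 \<in> {1..N + M - 1}" "i - 1 + 1 = i" using that by auto
    then show ?thesis using assms(22)[of "i - 1"] False by (simp add: g_def)
  qed
  interpret platoon \<alpha> \<beta> l K V T "N + M" Ia xl vl xo vo
  proof
    show "V s \<le> K" if "0 < s" for s using K[OF that] by simp
    show "0 < (xo(0 := xl 0)) (i - 1) - xo i - l" if "i \<in> {1..N + M}" for i
      using gap[OF that] assms(20) unfolding g_def by linarith
  qed (use assms leader in auto)
  \<comment> \<open>Vehicle \<open>i\<close> stops in time if it brakes at least at rate \<open>q i\<close>; \<open>r > 0\<close> is a rate that suits all.\<close>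
  define q where "q i = (vo i)\<^sup>2 / (g i - d_safe)" for i
  have q: "0 \<le> q i" if "i \<in> {1..N + M}" for i
    using gap[OF that] assms(24) by (simp add: q_def)
  define r where "r = 1 + (\<Sum>i\<in>{1..N + M}. q i)"
  have r: "0 < r" "q i \<le> r" if "i \<in> {1..N + M}" for i
    using q sum_nonneg[of "{1..N + M}" q] member_le_sum[of i "{1..N + M}" q] that
    by (simp_all add: r_def add_pos_nonneg)
  have r_pos: "0 < r"
    using r(1)[of 1] assms(9) by simp
  have nonempty: "admissible_controls T l \<alpha> \<beta> V I Ia xl vl xo vo d_safe a_min a_max \<noteq> {}"
    if "a_min \<le> - r" for a_min
  proof -
    have "(vo i)\<^sup>2 / (- a_min) \<le> (xo(0 := xl 0)) (i - 1) - xo i - l - d_safe" if i: "i \<in> Ia" for i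
    proof -
      have i': "i \<in> {1..N + M}" using i Ia by blast
      have "q i \<le> - a_min" using r(2)[OF i'] \<open>a_min \<le> - r\<close> by simp
      then have "(vo i)\<^sup>2 \<le> (- a_min) * (g i - d_safe)"
        using gap[OF i'] assms(24) by (simp add: q_def divide_le_eq)
      then have "(vo i)\<^sup>2 / (- a_min) \<le> g i - d_safe"
        using \<open>a_min \<le> - r\<close> r_pos pos_divide_le_eq[of "- a_min"] by (simp only: mult.commute)
      then show ?thesis by (simp only: g_def)
    qed
    from braking_control_keeps_distance[OF _ assms(25) this]
    show ?thesis
      using \<open>a_min \<le> - r\<close> r_pos assms(11) by auto
  qed
  have unique: "ex_unique_solution T l \<alpha> \<beta> V I Ia xl vl xo vo u"
    if "u \<in> admissible_controls T l \<alpha> \<beta> V I Ia xl vl xo vo d_safe a_min a_max" for u a_min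
    using ex_unique_solution_forward_control[OF control_set_imp_forward_control] that assms(11)
    by (auto simp: admissible_controls_def)
  show ?thesis
    using nonempty unique r_pos by (intro exI[of _ "- r"]) auto
qed

end
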